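(* Let $H_1,H_2$ be Hilbert spaces, $A\in\mathcal{B}(H_2)$ positive and $X\in\mathcal{B}(H_2,H_1)$, and suppose $T=\begin{bmatrix}I_{H_1} & X\\ X^* & A\end{bmatrix}$ is a positive operator on $H_1\oplus H_2$. Then $T\in\mathcal{AN}(H_1\oplus H_2)$ if and only if $A\in\mathcal{AN}(H_2)$ with $\sigma_{ess}(A)=\{1\}$ and $X$ has finite rank.
   Context: Throughout, Hilbert spaces are complex, separable and infinite dimensional; $\mathcal{B}(H_1,H_2)$ denotes bounded linear operators. An operator $S\in\mathcal{B}(H_1,H_2)$ is norm attaining if there is a unit vector $x\in H_1$ with $\|Sx\|=\|S\|$; $S$ is absolutely norm attaining, written $S\in\mathcal{AN}(H_1,H_2)$ (and $\mathcal{AN}(H)=\mathcal{AN}(H,H)$), if for every nonzero closed subspace $M\subseteq H_1$ the restriction $S|_M$ is norm attaining. $\sigma_{ess}(R)$ for $R\in\mathcal{B}(H)$ is the set of $\lambda\in\mathbb{C}$ with $R-\lambda I$ not Fredholm. *)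

theory Defs
  imports "HOL-Analysis.Analysis"
begin

text \<open>A complex Hilbert space is encoded as a real Hilbert space
  (type class real_inner + complete_space) together with an orthogonal
  complex structure J (multiplication by the imaginary unit).\<close>

definition complex_structure :: "('a::real_inner \<Rightarrow> 'a) \<Rightarrow> bool" where
  "complex_structure J \<longleftrightarrow> linear J \<and> (\<forall>x. J (J x) = - x) \<and> (\<forall>x y. inner (J x) (J y) = inner x y)"

definition scaleC :: "('a::real_vector \<Rightarrow> 'a) \<Rightarrow> complex \<Rightarrow> 'a \<Rightarrow> 'a" where
  "scaleC J c x = Re c *\<^sub>R x + Im c *\<^sub>R J x"

text \<open>complex inner product, linear in the first and conjugate linear in the second argument\<close>
definition cinner :: "('a::real_inner \<Rightarrow> 'a) \<Rightarrow> 'a \<Rightarrow> 'a \<Rightarrow> complex" where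
  "cinner J x y = Complex (inner x y) (inner x (J y))"

definition cspan :: "('a::real_vector \<Rightarrow> 'a) \<Rightarrow> 'a set \<Rightarrow> 'a set" where
  "cspan J S = {\<Sum>x\<in>F. scaleC J (c x) x | F c. finite F \<and> F \<subseteq> S}"

definition csubspace :: "('a::real_vector \<Rightarrow> 'a) \<Rightarrow> 'a set \<Rightarrow> bool" where
  "csubspace J M \<longleftrightarrow> subspace M \<and> (\<forall>x\<in>M. J x \<in> M)"

definition cfinite_dim :: "('a::real_vector \<Rightarrow> 'a) \<Rightarrow> 'a set \<Rightarrow> bool" where
  "cfinite_dim J M \<longleftrightarrow> (\<exists>B. finite B \<and> M \<subseteq> cspan J B)"

definition complex_hilbert :: "('a::{real_inner,complete_space} \<Rightarrow> 'a) \<Rightarrow> bool" where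
  "complex_hilbert J \<longleftrightarrow> complex_structure J \<and> separable_space (euclidean :: 'a topology)
     \<and> \<not> cfinite_dim J (UNIV :: 'a set)"

definition clinear :: "('a::real_vector \<Rightarrow> 'a) \<Rightarrow> ('b::real_vector \<Rightarrow> 'b) \<Rightarrow> ('a \<Rightarrow> 'b) \<Rightarrow> bool" where
  "clinear J1 J2 f \<longleftrightarrow> linear f \<and> (\<forall>x. f (J1 x) = J2 (f x))"

definition bounded_op :: "('a::real_normed_vector \<Rightarrow> 'a) \<Rightarrow> ('b::real_normed_vector \<Rightarrow> 'b) \<Rightarrow> ('a \<Rightarrow> 'b) \<Rightarrow> bool" where
  "bounded_op J1 J2 f \<longleftrightarrow> bounded_linear f \<and> clinear J1 J2 f"

definition positive_op :: "('a::real_inner \<Rightarrow> 'a) \<Rightarrow> ('a \<Rightarrow> 'a) \<Rightarrow> bool" where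
  "positive_op J A \<longleftrightarrow> (\<forall>x. Im (cinner J (A x) x) = 0 \<and> Re (cinner J (A x) x) \<ge> 0)"

definition norm_attaining_on :: "('a::real_normed_vector \<Rightarrow> 'b::real_normed_vector) \<Rightarrow> 'a set \<Rightarrow> bool" where
  "norm_attaining_on S M \<longleftrightarrow>
     (\<exists>x\<in>M. norm x = 1 \<and> norm (S x) = (SUP y\<in>{y\<in>M. norm y = 1}. norm (S y)))"

definition abs_norm_attaining :: "('a::real_normed_vector \<Rightarrow> 'a) \<Rightarrow> ('a \<Rightarrow> 'b::real_normed_vector) \<Rightarrow> bool" where
  "abs_norm_attaining J S \<longleftrightarrow>
     (\<forall>M. csubspace J M \<and> closed M \<and> M \<noteq> {0} \<longrightarrow> norm_attaining_on S M)"

definition fredholm :: "('a::real_normed_vector \<Rightarrow> 'a) \<Rightarrow> ('b::real_normed_vector \<Rightarrow> 'b) \<Rightarrow> ('a \<Rightarrow> 'b) \<Rightarrow> bool" where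
  "fredholm J1 J2 S \<longleftrightarrow> closed (range S) \<and> cfinite_dim J1 {x. S x = 0}
     \<and> (\<exists>B. finite B \<and> (\<forall>y. \<exists>x w. w \<in> cspan J2 B \<and> y = S x + w))"

definition ess_spectrum :: "('a::real_normed_vector \<Rightarrow> 'a) \<Rightarrow> ('a \<Rightarrow> 'a) \<Rightarrow> complex set" where
  "ess_spectrum J R = {c. \<not> fredholm J J (\<lambda>x. R x - scaleC J c x)}"

definition prod_J :: "('a \<Rightarrow> 'a) \<Rightarrow> ('b \<Rightarrow> 'b) \<Rightarrow> 'a \<times> 'b \<Rightarrow> 'a \<times> 'b" where
  "prod_J J1 J2 = (\<lambda>(x, y). (J1 x, J2 y))"

definition block_op :: "('b \<Rightarrow> 'a::real_vector) \<Rightarrow> ('a \<Rightarrow> 'b::real_vector) \<Rightarrow> ('b \<Rightarrow> 'b) \<Rightarrow> 'a \<times> 'b \<Rightarrow> 'a \<times> 'b" where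
  "block_op X Xs A = (\<lambda>(x, y). (x + X y, Xs x + A y))"

end

theory Submission
  imports Defs
begin

text \<open>Norm attainment is controlled by \<open>T\<^sup>* T\<close> modulo finite-dimensional subspaces. \<open>T\<close> is absolutely
  norm attaining iff for some \<open>\<beta>\<close> it satisfies \<open>\<beta> \<parallel>x\<parallel>\<^sup>2 \<le> \<parallel>T x\<parallel>\<^sup>2\<close> on a subspace of finite codimension
  and, for each \<open>\<epsilon> > 0\<close>, \<open>\<parallel>T x\<parallel>\<^sup>2 \<le> (\<beta> + \<epsilon>) \<parallel>x\<parallel>\<^sup>2\<close> on another one. If \<open>T\<close> is also positive,
  \<open>T - \<surd>\<beta>\<close> is arbitrarily small on subspaces of finite codimension, so its essential spectrum is
  \<open>{\<surd>\<beta>}\<close>. For the block operator the identity corner forces \<open>\<beta> = 1\<close>, and the lower bound,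
  tested on \<open>(x, - X\<^sup>* x / 2)\<close>, forces \<open>X\<^sup>* x = 0\<close> for \<open>x\<close> in a subspace of finite codimension. Once
  \<open>X\<close> has finite rank, \<open>T\<close> agrees with \<open>I \<oplus> A\<close> on a subspace of finite codimension, so the two
  conditions for \<open>T\<close> and for \<open>A\<close> are equivalent.\<close>

subsection \<open>Orthogonal complements of finite sets\<close>

text \<open>Closed subspaces of finite codimension are represented as
  \<open>B\<^sup>\<bottom>\<close> with \<open>B\<close> finite. No spectral theorem or weak
  topology has to be set up, because the compactness argument involves only finitely many
  functionals. The complements are real and need not be invariant under the complex structure;
  complex spans are handled by enlarging \<open>B\<close> with its image under \<open>J\<close>.

  The two bounds on \<open>(norm (T x))\<^sup>2\<close> are asymmetric for a reason. Values above
  \<beta> can accumulate only at \<beta>, so a supremum exceeding \<beta> is separated from the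
  accumulation point and is attained. Values strictly below \<beta> that accumulate at \<beta> would
  yield a subspace on which the supremum \<beta> is approached and not reached. Hence the lower
  bound has to hold with \<beta> itself, without an \<epsilon>.

  This exactness is what produces finite rank: bounds with an \<epsilon> on both sides would make
  \<open>Xs\<close> small on subspaces of finite codimension, that is compact, whereas the exact one
  makes it vanish on one of them.\<close>

lemma mem_orthogonal_comp: "x \<in> B\<^sup>\<bottom> \<longleftrightarrow> (\<forall>b\<in>B. x \<bullet> b = 0)"
  by (simp add: orthogonal_comp_def orthogonal_def inner_commute)

lemma orthogonal_comp_span:
  assumes "x \<in> B\<^sup>\<bottom>" "y \<in> span B"
  shows "x \<bullet> y = 0"
  using assms(2)
proof (induction rule: span_induct_alt)
  case base
  then show ?case by simp
next
  case (step c b y)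
  then show ?case using assms(1) by (simp add: mem_orthogonal_comp inner_add_right)
qed

lemma closed_orthogonal_comp: "closed ((B::'a::real_inner set)\<^sup>\<bottom>)"
proof -
  have "B\<^sup>\<bottom> = (\<Inter>b\<in>B. {x. x \<bullet> b = 0})"
    by (auto simp: mem_orthogonal_comp)
  moreover have "closed {x::'a. x \<bullet> b = 0}" for b
    by (intro closed_Collect_eq continuous_intros)
  ultimately show ?thesis by auto
qed

text \<open>Gram-Schmidt by induction: the normalised component of \<open>b\<close> orthogonal to
  \<open>B\<close> is split off from \<open>P\<close>. The bound on \<open>norm (P x)\<close> serves
  the contraction argument for the Fredholm property.\<close>

lemma orthogonal_projection_finite:
  fixes B :: "'a::real_inner set"
  assumes "finite B"
  shows "\<exists>P. linear P \<and> (\<forall>x. x - P x \<in> span B \<and> P x \<in> B\<^sup>\<bottom> \<and> norm (P x) \<le> norm x)"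
  using assms
proof (induction B)
  case empty
  show ?case
    by (rule exI[of _ "\<lambda>x. x"]) (auto simp: mem_orthogonal_comp linear_id[unfolded id_def])
next
  case (insert b B)
  then obtain P where P: "linear P" "\<And>x. x - P x \<in> span B" "\<And>x. P x \<in> B\<^sup>\<bottom>"
    "\<And>x. norm (P x) \<le> norm x" by blast
  \<comment> \<open>If \<open>b\<close> already lies in \<open>span B\<close>, then
    \<open>P b = 0\<close>, and \<open>sgn 0 = 0\<close> makes the new map equal to
    \<open>P\<close>; one formula serves both cases.\<close>
  define e where "e = sgn (P b)"
  have sub: "span B \<subseteq> span (insert b B)"
    by (rule span_mono) auto
  have "b - P b \<in> span (insert b B)"
    using P(2)[of b] sub by blast
  from span_diff[OF _ this, of b] have Pb: "P b \<in> span (insert b B)"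
    by (simp add: span_base)
  have e_span: "e \<in> span (insert b B)"
    using Pb by (simp add: e_def sgn_div_norm span_scale)
  have eB: "e \<in> B\<^sup>\<bottom>"
    using P(3)[of b] by (simp add: e_def sgn_div_norm mem_orthogonal_comp)
  have Pe: "P x \<bullet> e = x \<bullet> e" for x
    using orthogonal_comp_span[OF eB P(2)[of x]] by (simp add: inner_diff_right inner_commute)
  define Q where "Q = (\<lambda>x. P x - (x \<bullet> e) *\<^sub>R e)"
  have "linear Q"
    unfolding Q_def using P(1)
    by (intro linearI) (simp_all add: linear_add linear_scale algebra_simps)
  moreover have span_Q: "x - Q x \<in> span (insert b B)" for x
  proof -
    have "(x - P x) + (x \<bullet> e) *\<^sub>R e \<in> span (insert b B)"
      using P(2)[of x] sub e_span by (intro span_add span_scale) auto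
    then show ?thesis by (simp add: Q_def algebra_simps)
  qed
  moreover have Q_perp: "Q x \<in> (insert b B)\<^sup>\<bottom>" for x
  proof -
    have "Q x \<in> B\<^sup>\<bottom>"
      using P(3)[of x] eB by (simp add: Q_def mem_orthogonal_comp inner_diff_left)
    moreover have "Q x \<bullet> b = 0"
    proof -
      have "Q x \<bullet> b = Q x \<bullet> P b"
        using orthogonal_comp_span[OF \<open>Q x \<in> B\<^sup>\<bottom>\<close> P(2)[of b]] by (simp add: inner_diff_right)
      also have "P b = norm (P b) *\<^sub>R e"
        by (cases "P b = 0") (auto simp: e_def sgn_div_norm)
      also have "Q x \<bullet> (norm (P b) *\<^sub>R e) = norm (P b) * (x \<bullet> e) * (1 - e \<bullet> e)"
        by (simp add: Q_def inner_diff_left Pe algebra_simps)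
      also have "\<dots> = 0"
        by (cases "P b = 0") (auto simp: e_def dot_square_norm norm_sgn)
      finally show ?thesis .
    qed
    ultimately show ?thesis by (simp add: mem_orthogonal_comp)
  qed
  moreover have "norm (Q x) \<le> norm x" for x
  proof -
    have "Q x \<bullet> (x - Q x) = 0"
      by (rule orthogonal_comp_span[OF Q_perp span_Q])
    then have "(norm x)\<^sup>2 = (norm (Q x))\<^sup>2 + (norm (x - Q x))\<^sup>2"
      by (simp add: power2_norm_eq_inner inner_diff_left inner_diff_right inner_commute)
    then have "(norm (Q x))\<^sup>2 \<le> (norm x)\<^sup>2" by simp
    then show ?thesis by (rule power2_le_imp_le) simp
  qed
  ultimately show ?case by blast
qed

text \<open>\<open>M\<close> is the sum of \<open>M \<inter> B\<^sup>\<bottom>\<close> and the span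
  of vectors chosen triangularly: each new one is orthogonal to the earlier functionals and has
  product 1 with \<open>b\<close>, unless \<open>b\<close> vanishes on what is left. The splitting
  is not orthogonal, so the bound on \<open>u\<close> by the numbers \<open>z \<bullet> b\<close> is
  carried along; it later turns coercivity on \<open>M \<inter> B\<^sup>\<bottom>\<close> into
  coercivity modulo finitely many functionals.\<close>

lemma subspace_decomposition_finite:
  fixes B :: "'a::real_inner set"
  assumes "finite B" and M: "subspace M"
  shows "\<exists>C K. finite C \<and> C \<subseteq> M \<and> 0 \<le> K \<and>
    (\<forall>z\<in>M. \<exists>u\<in>span C. z - u \<in> B\<^sup>\<bottom> \<and> norm u \<le> K * (\<Sum>b\<in>B. \<bar>z \<bullet> b\<bar>))"
  using assms(1)
proof (induction B)
  case empty
  show ?case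
    by (rule exI[of _ "{}"], rule exI[of _ 0]) (auto simp: mem_orthogonal_comp)
next
  case (insert b B)
  then obtain C K where C: "finite C" "C \<subseteq> M" "0 \<le> K"
    and D: "\<And>z. z \<in> M \<Longrightarrow> \<exists>u\<in>span C. z - u \<in> B\<^sup>\<bottom> \<and> norm u \<le> K * (\<Sum>b\<in>B. \<bar>z \<bullet> b\<bar>)"
    by blast
  have spanM: "span C \<subseteq> M"
    using C(2) M by (simp add: span_minimal)
  show ?case
  proof (cases "\<forall>z\<in>M \<inter> B\<^sup>\<bottom>. z \<bullet> b = 0")
    case True
    have "\<exists>u\<in>span C. z - u \<in> (insert b B)\<^sup>\<bottom> \<and> norm u \<le> K * (\<Sum>b\<in>insert b B. \<bar>z \<bullet> b\<bar>)"
      if z: "z \<in> M" for z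
    proof -
      obtain u where u: "u \<in> span C" "z - u \<in> B\<^sup>\<bottom>" "norm u \<le> K * (\<Sum>b\<in>B. \<bar>z \<bullet> b\<bar>)"
        using D[OF z] by blast
      have "z - u \<in> M" using z u(1) spanM M by (auto intro: subspace_diff)
      then have "(z - u) \<bullet> b = 0" using True u(2) by auto
      moreover have "K * (\<Sum>b\<in>B. \<bar>z \<bullet> b\<bar>) \<le> K * (\<Sum>b\<in>insert b B. \<bar>z \<bullet> b\<bar>)"
        using C(3) insert.hyps by (intro mult_left_mono) auto
      ultimately show ?thesis
        using u by (intro bexI[of _ u]) (auto simp: mem_orthogonal_comp)
    qed
    then show ?thesis using C by blast
  next
    case False
    then obtain c0 where c0: "c0 \<in> M" "c0 \<in> B\<^sup>\<bottom>" "c0 \<bullet> b \<noteq> 0" by auto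
    define c where "c = (1 / (c0 \<bullet> b)) *\<^sub>R c0"
    have c: "c \<in> M" "c \<in> B\<^sup>\<bottom>" "c \<bullet> b = 1"
      using c0 M by (auto simp: c_def subspace_scale mem_orthogonal_comp)
    \<comment> \<open>One constant dominating both coefficients in \<open>norm w \<le> (1 + norm b *
      norm c) * K * \<Sigma> + norm c * \<bar>z \<bullet> b\<bar>\<close>, where
      \<open>\<Sigma>\<close> is the sum over the old functionals.\<close>
    define K' where "K' = K + norm c * (1 + K * norm b)"
    have K': "0 \<le> K'" "K \<le> K'" "norm c \<le> K'"
      using C(3) by (auto simp: K'_def algebra_simps)
    have "\<exists>u\<in>span (insert c C). z - u \<in> (insert b B)\<^sup>\<bottom> \<and>
        norm u \<le> K' * (\<Sum>b\<in>insert b B. \<bar>z \<bullet> b\<bar>)" if z: "z \<in> M" for z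
    proof -
      obtain u where u: "u \<in> span C" "z - u \<in> B\<^sup>\<bottom>" "norm u \<le> K * (\<Sum>b\<in>B. \<bar>z \<bullet> b\<bar>)"
        using D[OF z] by blast
      define w where "w = u + ((z - u) \<bullet> b) *\<^sub>R c"
      have "w \<in> span (insert c C)"
        unfolding w_def using u(1) span_mono[of C "insert c C"]
        by (intro span_add span_scale) (auto intro: span_base)
      moreover have "z - w \<in> (insert b B)\<^sup>\<bottom>"
        using u(2) c by (auto simp: w_def mem_orthogonal_comp inner_diff_left inner_add_left)
      moreover have "norm w \<le> K' * (\<Sum>b\<in>insert b B. \<bar>z \<bullet> b\<bar>)"
      proof -
        define \<Sigma> where "\<Sigma> = (\<Sum>b\<in>B. \<bar>z \<bullet> b\<bar>)"
        have "0 \<le> \<Sigma>" by (simp add: \<Sigma>_def sum_nonneg)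
        have "\<bar>(z - u) \<bullet> b\<bar> \<le> \<bar>z \<bullet> b\<bar> + norm u * norm b"
          using Cauchy_Schwarz_ineq2[of u b] by (simp add: inner_diff_left)
        then have "norm w \<le> norm u + (\<bar>z \<bullet> b\<bar> + norm u * norm b) * norm c"
          unfolding w_def by (intro norm_triangle_le) (simp add: mult_right_mono)
        also have "\<dots> \<le> K * \<Sigma> + (\<bar>z \<bullet> b\<bar> + K * \<Sigma> * norm b) * norm c"
          using u(3) unfolding \<Sigma>_def[symmetric]
          by (intro add_mono mult_right_mono order_refl) auto
        also have "\<dots> \<le> K' * \<Sigma> + K' * \<bar>z \<bullet> b\<bar>"
          using \<open>0 \<le> \<Sigma>\<close> mult_right_mono[OF K'(3), of "\<bar>z \<bullet> b\<bar>"]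
          by (simp add: K'_def algebra_simps)
        finally show ?thesis
          using insert.hyps by (simp add: \<Sigma>_def algebra_simps)
      qed
      ultimately show ?thesis by blast
    qed
    then show ?thesis
      using C c(1) K'(1) by (intro exI[of _ "insert c C"] exI[of _ K']) auto
  qed
qed

lemma finite_dim_of_trivial_annihilator:
  fixes M :: "'a::real_inner set"
  assumes "finite B" "subspace M" "M \<inter> B\<^sup>\<bottom> \<subseteq> {0}"
  shows "\<exists>C. finite C \<and> M \<subseteq> span C"
proof -
  obtain C K where C: "finite C" "C \<subseteq> M"
    and D: "\<And>z. z \<in> M \<Longrightarrow> \<exists>u\<in>span C. z - u \<in> B\<^sup>\<bottom> \<and> norm u \<le> K * (\<Sum>b\<in>B. \<bar>z \<bullet> b\<bar>)"
    using subspace_decomposition_finite[OF assms(1,2)] by blast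
  have "z \<in> span C" if z: "z \<in> M" for z
  proof -
    obtain u where u: "u \<in> span C" "z - u \<in> B\<^sup>\<bottom>" using D[OF z] by blast
    moreover have "z - u \<in> M"
      using z u(1) C(2) assms(2) span_minimal[of C M] by (auto intro: subspace_diff)
    ultimately show ?thesis using assms(3) by auto
  qed
  then show ?thesis using C by blast
qed

text \<open>Dependent choice on pairs of a finite set and a vector: the set gathers the images under
  \<open>G\<close> of all earlier vectors, and the next vector is taken orthogonal to it. Several
  maps in \<open>G\<close> give orthogonality for several forms at once.\<close>

lemma orthogonal_sequence_exists:
  fixes G :: "('a::real_inner \<Rightarrow> 'a) set" and P :: "nat \<Rightarrow> 'a \<Rightarrow> bool"
  assumes "finite G" and ex: "\<And>n B. finite B \<Longrightarrow> \<exists>x\<in>B\<^sup>\<bottom>. P n x"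
  shows "\<exists>e :: nat \<Rightarrow> 'a. (\<forall>n. P n (e n)) \<and> (\<forall>m n. \<forall>g\<in>G. m < n \<longrightarrow> e n \<bullet> g (e m) = 0)"
proof -
  have "\<exists>f. \<forall>n. (finite (fst (f n)) \<and> P n (snd (f n)) \<and> snd (f n) \<in> (fst (f n))\<^sup>\<bottom>) \<and>
      fst (f (Suc n)) = fst (f n) \<union> (\<lambda>g. g (snd (f n))) ` G"
  proof (rule dependent_nat_choice)
    show "\<exists>x. finite (fst x) \<and> P 0 (snd x) \<and> snd x \<in> (fst x)\<^sup>\<bottom>"
    proof -
      obtain y where "P 0 y" "y \<in> {}\<^sup>\<bottom>" using ex[of "{}" 0] by auto
      then show ?thesis by (intro exI[of _ "({}, y)"]) simp
    qed
    fix x n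
    assume x: "finite (fst x) \<and> P n (snd x) \<and> snd x \<in> (fst x)\<^sup>\<bottom>"
    define S where "S = fst x \<union> (\<lambda>g. g (snd x)) ` G"
    have "finite S" using x assms(1) by (simp add: S_def)
    then obtain y where "y \<in> S\<^sup>\<bottom>" "P (Suc n) y" using ex by blast
    then show "\<exists>y. (finite (fst y) \<and> P (Suc n) (snd y) \<and> snd y \<in> (fst y)\<^sup>\<bottom>) \<and>
        fst y = fst x \<union> (\<lambda>g. g (snd x)) ` G"
      using \<open>finite S\<close> unfolding S_def by (intro exI[of _ "(fst x \<union> (\<lambda>g. g (snd x)) ` G, y)"]) simp
  qed
  then obtain f where f: "\<And>n. P n (snd (f n))" "\<And>n. snd (f n) \<in> (fst (f n))\<^sup>\<bottom>"
    "\<And>n. fst (f (Suc n)) = fst (f n) \<union> (\<lambda>g. g (snd (f n))) ` G" by auto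
  have mono: "fst (f m) \<subseteq> fst (f n)" if "m \<le> n" for m n
    using lift_Suc_mono_le[of "\<lambda>n. fst (f n)" m n] f(3) that by simp
  have "snd (f n) \<bullet> g (snd (f m)) = 0" if "m < n" "g \<in> G" for m n g
  proof -
    have "g (snd (f m)) \<in> fst (f (Suc m))" using f(3)[of m] that(2) by simp
    then have "g (snd (f m)) \<in> fst (f n)" using mono[of "Suc m" n] that(1) by auto
    then show ?thesis using f(2)[of n] by (simp add: mem_orthogonal_comp)
  qed
  then show ?thesis
    using f(1) by (intro exI[of _ "\<lambda>n. snd (f n)"]) simp
qed

text \<open>Bolzano-Weierstrass, one functional at a time; this takes the place of weak sequential
  compactness of the unit ball.\<close>

lemma convergent_inner_subsequence:
  fixes x :: "nat \<Rightarrow> 'a::real_inner"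
  assumes "finite B" and bd: "\<And>n. norm (x n) \<le> 1"
  shows "\<exists>r. strict_mono (r::nat \<Rightarrow> nat) \<and> (\<forall>b\<in>B. convergent (\<lambda>n. x (r n) \<bullet> b))"
  using assms(1)
proof (induction B)
  case empty
  then show ?case by (auto intro: strict_mono_id)
next
  case (insert b B)
  then obtain r where r: "strict_mono r" "\<And>b. b \<in> B \<Longrightarrow> convergent (\<lambda>n. x (r n) \<bullet> b)" by blast
  have "bounded (range (\<lambda>n. x (r n) \<bullet> b))"
  proof (rule boundedI)
    fix t assume "t \<in> range (\<lambda>n. x (r n) \<bullet> b)"
    then obtain n where "t = x (r n) \<bullet> b" by auto
    then have "norm t \<le> norm (x (r n)) * norm b"
      using Cauchy_Schwarz_ineq2 by simp
    also have "\<dots> \<le> 1 * norm b" using bd by (intro mult_right_mono) auto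
    finally show "norm t \<le> norm b" by simp
  qed
  then obtain l r' where r': "strict_mono r'" "((\<lambda>n. x (r n) \<bullet> b) \<circ> r') \<longlonglongrightarrow> l"
    using bounded_imp_convergent_subsequence by blast
  have "convergent (\<lambda>n. x ((r \<circ> r') n) \<bullet> b')" if "b' \<in> insert b B" for b'
  proof (cases "b' = b")
    case True
    then show ?thesis using r'(2) by (auto simp: convergent_def o_def)
  next
    case False
    then have "convergent (\<lambda>n. x (r n) \<bullet> b')" using that r(2) by auto
    from convergent_subseq_convergent[OF this r'(1)] show ?thesis by (simp add: o_def)
  qed
  then show ?case using strict_mono_o[OF r(1) r'(1)] by blast
qed

subsection \<open>A sufficient condition for absolute norm attainment\<close>

lemma parallelogram:
  fixes x y :: "'a::real_inner"
  shows "(norm (x + y))\<^sup>2 + (norm (x - y))\<^sup>2 = 2 * (norm x)\<^sup>2 + 2 * (norm y)\<^sup>2"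
  by (simp add: power2_norm_eq_inner inner_add inner_diff algebra_simps inner_commute)

text \<open>Split \<open>z\<close> as \<open>(z - u) + u\<close> with \<open>u\<close> controlled by
  the functionals. The form \<open>q\<close> satisfies the parallelogram law and is nonnegative on
  \<open>M\<close>, so \<open>q (z - u) \<le> 2 * q z + 2 * q u\<close>, and coercivity on
  \<open>B\<^sup>\<bottom>\<close> bounds \<open>z - u\<close>.\<close>

lemma coercive_modulo_finite:
  fixes T :: "'a::real_inner \<Rightarrow> 'b::real_inner"
  assumes T: "linear T" and M: "subspace M" and B: "finite B" and c: "c > 0" and s: "0 \<le> s"
    and nonneg: "\<And>x. x \<in> M \<Longrightarrow> (norm (T x))\<^sup>2 \<le> s * (norm x)\<^sup>2"
    and coercive: "\<And>x. x \<in> M \<Longrightarrow> x \<in> B\<^sup>\<bottom> \<Longrightarrow> c * (norm x)\<^sup>2 \<le> s * (norm x)\<^sup>2 - (norm (T x))\<^sup>2"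
  shows "\<exists>K\<ge>0. \<forall>z\<in>M. (norm z)\<^sup>2 \<le>
    K * ((s * (norm z)\<^sup>2 - (norm (T z))\<^sup>2) + (\<Sum>b\<in>B. \<bar>z \<bullet> b\<bar>)\<^sup>2)"
proof -
  obtain C k where C: "finite C" "C \<subseteq> M" "0 \<le> k"
    and D: "\<And>z. z \<in> M \<Longrightarrow> \<exists>u\<in>span C. z - u \<in> B\<^sup>\<bottom> \<and> norm u \<le> k * (\<Sum>b\<in>B. \<bar>z \<bullet> b\<bar>)"
    using subspace_decomposition_finite[OF B M] by blast
  define q where "q = (\<lambda>z. s * (norm z)\<^sup>2 - (norm (T z))\<^sup>2)"
  define K where "K = 4 / c + (2 + 4 * s / c) * k\<^sup>2"
  have "0 \<le> K" using c s by (simp add: K_def)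
  moreover have "(norm z)\<^sup>2 \<le> K * (q z + (\<Sum>b\<in>B. \<bar>z \<bullet> b\<bar>)\<^sup>2)" if z: "z \<in> M" for z
  proof -
    define \<sigma> where "\<sigma> = (\<Sum>b\<in>B. \<bar>z \<bullet> b\<bar>)"
    obtain u where u: "u \<in> span C" "z - u \<in> B\<^sup>\<bottom>" "norm u \<le> k * \<sigma>"
      using D[OF z] unfolding \<sigma>_def by blast
    have uM: "u \<in> M" using u(1) C(2) M span_minimal[of C M] by blast
    have qz: "0 \<le> q z" using nonneg[OF z] by (simp add: q_def)
    have nu: "(norm u)\<^sup>2 \<le> k\<^sup>2 * \<sigma>\<^sup>2"
      using power_mono[OF u(3), of 2] by (simp add: power_mult_distrib)
    have "q (z - u) + q (z + u) = 2 * q z + 2 * q u"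
      using arg_cong[OF parallelogram[of z u], of "\<lambda>t. s * t"] parallelogram[of "T z" "T u"] T
      by (simp add: q_def linear_diff linear_add distrib_left)
    moreover have "0 \<le> q (z + u)"
      using nonneg[OF subspace_add[OF M z uM]] by (simp add: q_def)
    moreover have "q u \<le> s * (norm u)\<^sup>2" by (simp add: q_def)
    moreover have "s * (norm u)\<^sup>2 \<le> s * (k\<^sup>2 * \<sigma>\<^sup>2)" using nu s by (rule mult_left_mono)
    moreover have "c * (norm (z - u))\<^sup>2 \<le> q (z - u)"
      using coercive[OF subspace_diff[OF M z uM] u(2)] by (simp add: q_def)
    ultimately have "c * (norm (z - u))\<^sup>2 \<le> 2 * q z + 2 * (s * (k\<^sup>2 * \<sigma>\<^sup>2))" by linarith
    then have y: "(norm (z - u))\<^sup>2 \<le> (2 * q z + 2 * (s * (k\<^sup>2 * \<sigma>\<^sup>2))) / c"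
      using c by (simp add: pos_le_divide_eq mult.commute)
    have "(norm z)\<^sup>2 \<le> 2 * (norm (z - u))\<^sup>2 + 2 * (norm u)\<^sup>2"
    proof -
      have "(norm z)\<^sup>2 + (norm (z - u - u))\<^sup>2 = 2 * (norm (z - u))\<^sup>2 + 2 * (norm u)\<^sup>2"
        using parallelogram[of "z - u" u] by simp
      moreover have "0 \<le> (norm (z - u - u))\<^sup>2" by simp
      ultimately show ?thesis by linarith
    qed
    also have "\<dots> \<le> 2 * ((2 * q z + 2 * (s * (k\<^sup>2 * \<sigma>\<^sup>2))) / c) + 2 * (k\<^sup>2 * \<sigma>\<^sup>2)"
      using y nu by linarith
    also have "\<dots> = 4 / c * q z + (2 + 4 * s / c) * k\<^sup>2 * \<sigma>\<^sup>2"
      using c by (simp add: field_simps)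
    also have "\<dots> \<le> K * (q z + \<sigma>\<^sup>2)"
      using qz c s unfolding K_def distrib_left
      by (intro add_mono mult_right_mono) auto
    finally show ?thesis by (simp add: \<sigma>_def)
  qed
  ultimately show ?thesis unfolding q_def by blast
qed

text \<open>Along a maximising sequence the form tends to zero, and on a subsequence the finitely
  many \<open>x n \<bullet> b\<close> converge. Coercivity modulo these functionals, applied to
  differences, makes the subsequence Cauchy in norm, and its limit is a maximiser.\<close>

lemma maximum_attained_of_coercive:
  fixes T :: "'a::{real_inner,complete_space} \<Rightarrow> 'b::real_inner"
  assumes T: "bounded_linear T" and M: "subspace M" and cl: "closed M"
    and B: "finite B" and c: "c > 0" and s: "0 \<le> s"
    and nonneg: "\<And>x. x \<in> M \<Longrightarrow> (norm (T x))\<^sup>2 \<le> s * (norm x)\<^sup>2"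
    and coercive: "\<And>x. x \<in> M \<Longrightarrow> x \<in> B\<^sup>\<bottom> \<Longrightarrow> c * (norm x)\<^sup>2 \<le> s * (norm x)\<^sup>2 - (norm (T x))\<^sup>2"
    and approx: "\<And>\<epsilon>. \<epsilon> > 0 \<Longrightarrow> \<exists>x\<in>M. norm x = 1 \<and> s - \<epsilon> < (norm (T x))\<^sup>2"
  shows "\<exists>x\<in>M. norm x = 1 \<and> (norm (T x))\<^sup>2 = s"
proof -
  interpret T: bounded_linear T by (rule T)
  obtain K where K: "0 \<le> K" "\<And>z. z \<in> M \<Longrightarrow> (norm z)\<^sup>2 \<le>
      K * ((s * (norm z)\<^sup>2 - (norm (T z))\<^sup>2) + (\<Sum>b\<in>B. \<bar>z \<bullet> b\<bar>)\<^sup>2)"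
    using coercive_modulo_finite[OF T.linear_axioms M B c s nonneg coercive] by blast
  have "\<forall>n. \<exists>x\<in>M. norm x = 1 \<and> s - inverse (real (Suc n)) < (norm (T x))\<^sup>2"
    by (intro allI approx) simp
  then obtain x0 where x0: "\<And>n. x0 n \<in> M" "\<And>n. norm (x0 n) = 1"
      "\<And>n. s - inverse (real (Suc n)) < (norm (T (x0 n)))\<^sup>2" by metis
  obtain r where r: "strict_mono r" "\<And>b. b \<in> B \<Longrightarrow> convergent (\<lambda>n. x0 (r n) \<bullet> b)"
    using convergent_inner_subsequence[OF B, of x0] x0(2) by auto
  define x where "x = (\<lambda>n. x0 (r n))"
  have xM: "x n \<in> M" and nx: "norm (x n) = 1" for n using x0 by (auto simp: x_def)
  have Tx: "(\<lambda>n. (norm (T (x n)))\<^sup>2) \<longlonglongrightarrow> s"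
  proof -
    have "(\<lambda>n. (norm (T (x0 n)))\<^sup>2) \<longlonglongrightarrow> s"
    proof (rule tendsto_sandwich)
      show "(\<lambda>n. s - inverse (real (Suc n))) \<longlonglongrightarrow> s"
        using tendsto_diff[OF tendsto_const LIMSEQ_inverse_real_of_nat, of s] by simp
      show "\<forall>\<^sub>F n in sequentially. s - inverse (real (Suc n)) \<le> (norm (T (x0 n)))\<^sup>2"
        using x0(3) by (intro always_eventually) (auto intro: less_imp_le)
      show "\<forall>\<^sub>F n in sequentially. (norm (T (x0 n)))\<^sup>2 \<le> s"
        using nonneg[OF x0(1)] x0(2) by simp
    qed simp
    from LIMSEQ_subseq_LIMSEQ[OF this r(1)] show ?thesis by (simp add: x_def o_def)
  qed
  define l where "l = (\<lambda>b. lim (\<lambda>n. x n \<bullet> b))"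
  have l: "(\<lambda>n. x n \<bullet> b) \<longlonglongrightarrow> l b" if "b \<in> B" for b
    using r(2)[OF that] by (simp add: l_def x_def convergent_LIMSEQ_iff)
  define a where "a = (\<lambda>n. \<Sum>b\<in>B. \<bar>x n \<bullet> b - l b\<bar>)"
  have a: "a \<longlonglongrightarrow> 0"
  proof -
    have "a \<longlonglongrightarrow> (\<Sum>b\<in>B. \<bar>l b - l b\<bar>)"
      unfolding a_def by (intro tendsto_intros l)
    then show ?thesis by simp
  qed
  define w where "w = (\<lambda>n. s - (norm (T (x n)))\<^sup>2)"
  define h where "h = (\<lambda>n. K * (2 * w n + 2 * (a n)\<^sup>2))"
  have h: "h \<longlonglongrightarrow> 0"
  proof -
    have "h \<longlonglongrightarrow> K * (2 * (s - s) + 2 * 0\<^sup>2)"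
      unfolding h_def w_def by (intro tendsto_intros a Tx)
    then show ?thesis by simp
  qed
  have key: "(norm (x n - x m))\<^sup>2 \<le> h n + h m" for n m
  proof -
    have d: "x n - x m \<in> M" by (rule subspace_diff[OF M xM xM])
    have "(norm (T (x n - x m)))\<^sup>2 = 2 * (norm (T (x n)))\<^sup>2 + 2 * (norm (T (x m)))\<^sup>2 - (norm (T (x n + x m)))\<^sup>2"
      using parallelogram[of "T (x n)" "T (x m)"] by (simp add: T.add T.diff)
    moreover have "s * (norm (x n - x m))\<^sup>2 = 4 * s - s * (norm (x n + x m))\<^sup>2"
      using arg_cong[OF parallelogram[of "x n" "x m"], of "\<lambda>t. s * t"] nx by (simp add: distrib_left)
    moreover have "(norm (T (x n + x m)))\<^sup>2 \<le> s * (norm (x n + x m))\<^sup>2"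
      by (rule nonneg[OF subspace_add[OF M xM xM]])
    ultimately have q: "s * (norm (x n - x m))\<^sup>2 - (norm (T (x n - x m)))\<^sup>2 \<le> 2 * w n + 2 * w m"
      unfolding w_def by (smt (verit))
    have "(\<Sum>b\<in>B. \<bar>(x n - x m) \<bullet> b\<bar>) \<le> a n + a m"
      unfolding a_def sum.distrib[symmetric]
      by (intro sum_mono) (simp add: inner_diff_left)
    then have "(\<Sum>b\<in>B. \<bar>(x n - x m) \<bullet> b\<bar>)\<^sup>2 \<le> (a n + a m)\<^sup>2"
      by (intro power_mono sum_nonneg) auto
    also have "\<dots> \<le> 2 * (a n)\<^sup>2 + 2 * (a m)\<^sup>2"
      using zero_le_power2[of "a n - a m"] by (simp add: power2_eq_square algebra_simps)
    finally have "K * ((s * (norm (x n - x m))\<^sup>2 - (norm (T (x n - x m)))\<^sup>2) + (\<Sum>b\<in>B. \<bar>(x n - x m) \<bullet> b\<bar>)\<^sup>2)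
        \<le> K * ((2 * w n + 2 * w m) + (2 * (a n)\<^sup>2 + 2 * (a m)\<^sup>2))"
      using q K(1) by (intro mult_left_mono add_mono)
    then show ?thesis
      using K(2)[OF d] by (simp add: h_def algebra_simps)
  qed
  have "Cauchy x"
  proof (rule CauchyI)
    fix e :: real assume "e > 0"
    then have "\<forall>\<^sub>F n in sequentially. h n < e\<^sup>2 / 2"
      using order_tendstoD(2)[OF h, of "e\<^sup>2 / 2"] by simp
    then obtain N where N: "\<And>n. n \<ge> N \<Longrightarrow> h n < e\<^sup>2 / 2"
      by (auto simp: eventually_sequentially)
    have "norm (x m - x n) < e" if "m \<ge> N" "n \<ge> N" for m n
    proof -
      have "(norm (x m - x n))\<^sup>2 < e\<^sup>2"
        using key[of m n] N[OF that(1)] N[OF that(2)] by simp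
      then show ?thesis using \<open>e > 0\<close> by (rule power2_less_imp_less[OF _ less_imp_le])
    qed
    then show "\<exists>M. \<forall>m\<ge>M. \<forall>n\<ge>M. norm (x m - x n) < e" by blast
  qed
  then obtain y where y: "x \<longlonglongrightarrow> y"
    using Cauchy_convergent convergent_def by blast
  have "y \<in> M" using closed_sequentially[OF cl _ y] xM by blast
  moreover have "norm y = 1"
    using LIMSEQ_unique[OF tendsto_norm[OF y]] nx by simp
  moreover have "(norm (T y))\<^sup>2 = s"
    using LIMSEQ_unique[OF tendsto_power[OF tendsto_norm[OF T.tendsto[OF y]], of 2] Tx] .
  ultimately show ?thesis by blast
qed

lemma norm_attaining_on_iff:
  assumes S: "bounded_linear S" and M: "subspace M"
  shows "norm_attaining_on S M \<longleftrightarrow> (\<exists>x\<in>M. norm x = 1 \<and> (\<forall>y\<in>M. norm (S y) \<le> norm (S x) * norm y))"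
proof
  interpret S: bounded_linear S by (rule S)
  assume "norm_attaining_on S M"
  then obtain x where x: "x \<in> M" "norm x = 1"
    "norm (S x) = (SUP y\<in>{y\<in>M. norm y = 1}. norm (S y))"
    by (auto simp: norm_attaining_on_def)
  have bdd: "bdd_above ((\<lambda>y. norm (S y)) ` {y\<in>M. norm y = 1})"
  proof -
    obtain K where "\<And>y. norm (S y) \<le> norm y * K" using S.bounded by blast
    then show ?thesis by (intro bdd_aboveI[of _ K]) (metis (mono_tags, lifting) imageE mem_Collect_eq mult_1)
  qed
  have "norm (S y) \<le> norm (S x) * norm y" if "y \<in> M" for y
  proof (cases "y = 0")
    case False
    have "sgn y \<in> {y\<in>M. norm y = 1}"
      using False that M by (auto simp: norm_sgn sgn_div_norm subspace_scale)
    then have "norm (S (sgn y)) \<le> norm (S x)"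
      unfolding x(3) by (rule cSUP_upper[OF _ bdd])
    then show ?thesis
      using False by (simp add: sgn_div_norm S.scaleR field_simps)
  qed (simp add: S.zero)
  then show "\<exists>x\<in>M. norm x = 1 \<and> (\<forall>y\<in>M. norm (S y) \<le> norm (S x) * norm y)"
    using x by blast
next
  assume "\<exists>x\<in>M. norm x = 1 \<and> (\<forall>y\<in>M. norm (S y) \<le> norm (S x) * norm y)"
  then obtain x where x: "x \<in> M" "norm x = 1" "\<And>y. y \<in> M \<Longrightarrow> norm (S y) \<le> norm (S x) * norm y"
    by blast
  have "(SUP y\<in>{y\<in>M. norm y = 1}. norm (S y)) = norm (S x)"
    by (rule cSup_eq_maximum) (use x in force)+
  then show "norm_attaining_on S M"
    using x by (auto simp: norm_attaining_on_def)
qed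

text \<open>In spectral terms: the essential spectrum of \<open>T\<^sup>* T\<close> is \<open>{\<beta>}\<close> and only finitely many
  eigenvalues, with multiplicity, lie below \<open>\<beta>\<close>.\<close>

definition ess_modulus :: "real \<Rightarrow> ('a::real_inner \<Rightarrow> 'b::real_normed_vector) \<Rightarrow> bool" where
  "ess_modulus \<beta> T \<longleftrightarrow>
     (\<exists>B. finite B \<and> (\<forall>x\<in>B\<^sup>\<bottom>. \<beta> * (norm x)\<^sup>2 \<le> (norm (T x))\<^sup>2)) \<and>
     (\<forall>\<epsilon>>0. \<exists>B. finite B \<and> (\<forall>x\<in>B\<^sup>\<bottom>. (norm (T x))\<^sup>2 \<le> (\<beta> + \<epsilon>) * (norm x)\<^sup>2))"

lemma ess_modulus_lowerE:
  assumes "ess_modulus \<beta> T"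
  obtains B where "finite B" "\<And>x. x \<in> B\<^sup>\<bottom> \<Longrightarrow> \<beta> * (norm x)\<^sup>2 \<le> (norm (T x))\<^sup>2"
  using assms by (auto simp: ess_modulus_def)

lemma ess_modulus_upperE:
  assumes "ess_modulus \<beta> T" "\<epsilon> > 0"
  obtains B where "finite B" "\<And>x. x \<in> B\<^sup>\<bottom> \<Longrightarrow> (norm (T x))\<^sup>2 \<le> (\<beta> + \<epsilon>) * (norm x)\<^sup>2"
  using assms unfolding ess_modulus_def by meson

text \<open>There are three situations for the supremum \<open>s\<close> over the unit sphere of
  \<open>M\<close>. If \<open>s\<close> exceeds \<beta>, the gap gives coercivity on a complement.
  If \<open>M\<close> is finite-dimensional, coercivity is vacuous. Otherwise the exact lower bound
  supplies a unit vector of \<open>M\<close> with value at least \<beta>, and \<beta> is at least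
  \<open>s\<close>.\<close>

lemma abs_norm_attaining_of_ess_modulus:
  fixes T :: "'a::{real_inner,complete_space} \<Rightarrow> 'b::real_inner"
  assumes T: "bounded_linear T" and ess: "ess_modulus \<beta> T"
  shows "abs_norm_attaining J T"
  unfolding abs_norm_attaining_def
proof (intro allI impI)
  fix M assume M: "csubspace J M \<and> closed M \<and> M \<noteq> {0}"
  interpret T: bounded_linear T by (rule T)
  have sub: "subspace M" and cl: "closed M" using M by (auto simp: csubspace_def)
  obtain v where v: "v \<in> M" "v \<noteq> 0"
    using M subspace_0[OF sub] by blast
  define U where "U = {y\<in>M. norm y = 1}"
  have "sgn v \<in> U"
    using v sub by (auto simp: U_def norm_sgn sgn_div_norm subspace_scale)
  obtain k where k: "\<And>y. norm (T y) \<le> norm y * k" using T.bounded by blast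
  have bdd: "bdd_above ((\<lambda>y. (norm (T y))\<^sup>2) ` U)"
  proof (rule bdd_aboveI2)
    fix y assume "y \<in> U"
    then have "norm (T y) \<le> k" using k[of y] by (simp add: U_def)
    then show "(norm (T y))\<^sup>2 \<le> k\<^sup>2" by (intro power_mono) auto
  qed
  define s where "s = (SUP y\<in>U. (norm (T y))\<^sup>2)"
  have upper: "(norm (T y))\<^sup>2 \<le> s" if "y \<in> U" for y
    unfolding s_def by (rule cSUP_upper[OF that bdd])
  have s0: "0 \<le> s" using upper[OF \<open>sgn v \<in> U\<close>] zero_le_power2 order_trans by blast
  have nonneg: "(norm (T y))\<^sup>2 \<le> s * (norm y)\<^sup>2" if "y \<in> M" for y
  proof (cases "y = 0")
    case False
    then have "sgn y \<in> U" using that sub by (auto simp: U_def norm_sgn sgn_div_norm subspace_scale)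
    from upper[OF this] False show ?thesis
      by (simp add: sgn_div_norm T.scaleR power_mult_distrib field_simps)
  qed (simp add: T.zero)
  have "\<exists>x\<in>M. norm x = 1 \<and> (norm (T x))\<^sup>2 = s"
  \<comment> \<open>The second condition says that \<open>M\<close> is infinite-dimensional.\<close>
  proof (cases "s \<le> \<beta> \<and> (\<forall>B. finite B \<longrightarrow> \<not> M \<inter> B\<^sup>\<bottom> \<subseteq> {0})")
    case True
    obtain B where B: "finite B" "\<And>x. x \<in> B\<^sup>\<bottom> \<Longrightarrow> \<beta> * (norm x)\<^sup>2 \<le> (norm (T x))\<^sup>2"
      using ess unfolding ess_modulus_def by blast
    obtain x where x: "x \<in> M" "x \<in> B\<^sup>\<bottom>" "x \<noteq> 0" using True B(1) by blast
    then have u: "sgn x \<in> U" using sub by (auto simp: U_def norm_sgn sgn_div_norm subspace_scale)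
    have "sgn x \<in> B\<^sup>\<bottom>" using x(2) by (simp add: sgn_div_norm mem_orthogonal_comp)
    from B(2)[OF this] have "\<beta> \<le> (norm (T (sgn x)))\<^sup>2" using x(3) by (simp add: norm_sgn)
    then have "(norm (T (sgn x)))\<^sup>2 = s" using upper[OF u] True by linarith
    then show ?thesis using u by (auto simp: U_def)
  next
    case False
    have "\<exists>B c. finite B \<and> c > 0 \<and>
      (\<forall>x\<in>M. x \<in> B\<^sup>\<bottom> \<longrightarrow> c * (norm x)\<^sup>2 \<le> s * (norm x)\<^sup>2 - (norm (T x))\<^sup>2)"
    proof (cases "s \<le> \<beta>")
      case True
      then obtain B where "finite B" "M \<inter> B\<^sup>\<bottom> \<subseteq> {0}" using False by blast
      then show ?thesis by (intro exI[of _ B] exI[of _ 1]) (auto simp: T.zero)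
    next
      case s: False
      \<comment> \<open>One half of the gap is spent as the \<epsilon> of the upper bound; the other
        half remains as the coercivity constant.\<close>
      then have "(s - \<beta>) / 2 > 0" by simp
      then obtain B where B: "finite B"
        "\<And>x. x \<in> B\<^sup>\<bottom> \<Longrightarrow> (norm (T x))\<^sup>2 \<le> (\<beta> + (s - \<beta>) / 2) * (norm x)\<^sup>2"
        using ess unfolding ess_modulus_def by blast
      have "(s - \<beta>) / 2 * (norm x)\<^sup>2 \<le> s * (norm x)\<^sup>2 - (norm (T x))\<^sup>2" if "x \<in> B\<^sup>\<bottom>" for x
      proof -
        have "(\<beta> + (s - \<beta>) / 2) * (norm x)\<^sup>2 = s * (norm x)\<^sup>2 - (s - \<beta>) / 2 * (norm x)\<^sup>2"
          by (simp add: field_simps)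
        then show ?thesis using B(2)[OF that] by linarith
      qed
      then show ?thesis
        using s B(1) by (intro exI[of _ B] exI[of _ "(s - \<beta>) / 2"]) simp
    qed
    then obtain B c where B: "finite B" "c > 0"
      "\<And>x. x \<in> M \<Longrightarrow> x \<in> B\<^sup>\<bottom> \<Longrightarrow> c * (norm x)\<^sup>2 \<le> s * (norm x)\<^sup>2 - (norm (T x))\<^sup>2" by blast
    show ?thesis
    proof (rule maximum_attained_of_coercive[OF T sub cl B(1,2) s0 nonneg B(3)])
      fix \<epsilon> :: real assume "\<epsilon> > 0"
      then have "\<exists>y\<in>U. s - \<epsilon> < (norm (T y))\<^sup>2"
        using \<open>sgn v \<in> U\<close> bdd unfolding s_def by (subst less_cSUP_iff[symmetric]) auto
      then show "\<exists>x\<in>M. norm x = 1 \<and> s - \<epsilon> < (norm (T x))\<^sup>2" by (auto simp: U_def)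
    qed
  qed
  then obtain x where x: "x \<in> M" "norm x = 1" "(norm (T x))\<^sup>2 = s" by blast
  have "norm (T y) \<le> norm (T x) * norm y" if "y \<in> M" for y
    by (rule power2_le_imp_le) (use nonneg[OF that] x(3) in \<open>simp_all add: power_mult_distrib\<close>)
  then show "norm_attaining_on T M"
    using x unfolding norm_attaining_on_iff[OF T sub] by blast
qed

subsection \<open>A necessary condition for absolute norm attainment\<close>

lemma subspace_closure:
  fixes S :: "'a::real_normed_vector set"
  assumes "subspace S"
  shows "subspace (closure S)"
proof (rule subspaceI)
  show "0 \<in> closure S" using subspace_0[OF assms] closure_subset by blast
  fix x y assume "x \<in> closure S" "y \<in> closure S"
  then obtain f g where "\<And>n. f n \<in> S" "f \<longlonglongrightarrow> x" "\<And>n. g n \<in> S" "g \<longlonglongrightarrow> y"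
    unfolding closure_sequential by blast
  then show "x + y \<in> closure S"
    unfolding closure_sequential
    by (intro exI[of _ "\<lambda>n. f n + g n"]) (auto intro: tendsto_add subspace_add[OF assms])
next
  fix c x assume "x \<in> closure S"
  then obtain f where "\<And>n. f n \<in> S" "f \<longlonglongrightarrow> x"
    unfolding closure_sequential by blast
  then show "c *\<^sub>R x \<in> closure S"
    unfolding closure_sequential
    by (intro exI[of _ "\<lambda>n. c *\<^sub>R f n"]) (auto intro: tendsto_intros subspace_scale[OF assms])
qed

lemma closure_span_induct:
  fixes V :: "'a::real_normed_vector set"
  assumes "x \<in> closure (span V)" "\<And>v. v \<in> V \<Longrightarrow> v \<in> S" "subspace S" "closed S"
  shows "x \<in> S"
  using assms closure_minimal[of "span V" S] span_minimal[of V S] by blast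

text \<open>Only the weak inequality passes to the closure. Equality at \<open>x\<close> makes
  \<open>x\<close> a minimum of the nonnegative form
  \<open>\<beta> * (norm y)\<^sup>2 - (norm (T y))\<^sup>2\<close>, so its polar form with every
  \<open>w\<close> in \<open>V\<close> vanishes. By the double orthogonality this polar form is a
  positive multiple of \<open>x \<bullet> w\<close>; hence \<open>x\<close> is orthogonal to
  \<open>V\<close> and to itself.\<close>

lemma strict_bound_on_closed_span:
  fixes T :: "'a::real_inner \<Rightarrow> 'b::real_inner"
  assumes T: "bounded_linear T"
    and orth: "pairwise orthogonal V" "pairwise (\<lambda>v w. orthogonal (T v) (T w)) V"
    and lt: "\<And>w. w \<in> V \<Longrightarrow> (norm (T w))\<^sup>2 < \<beta> * (norm w)\<^sup>2"
    and x: "x \<in> closure (span V)" "x \<noteq> 0"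
  shows "(norm (T x))\<^sup>2 < \<beta> * (norm x)\<^sup>2"
proof (rule ccontr)
  interpret T: bounded_linear T by (rule T)
  have cont: "continuous_on A T" for A by (rule T.continuous_on[OF continuous_on_id])
  let ?M = "closure (span V)"
  have le_span: "(norm (T y))\<^sup>2 \<le> \<beta> * (norm y)\<^sup>2" if y: "y \<in> span V" for y
  proof -
    obtain t r where t: "finite t" "t \<subseteq> V" "y = (\<Sum>w\<in>t. r w *\<^sub>R w)"
      using y by (auto simp: span_explicit)
    have o: "pairwise (\<lambda>v w. orthogonal (r v *\<^sub>R v) (r w *\<^sub>R w)) t"
      "pairwise (\<lambda>v w. orthogonal (r v *\<^sub>R T v) (r w *\<^sub>R T w)) t"
      using orth t(2) by (auto simp: pairwise_def orthogonal_clauses subset_iff)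
    have "(norm (T y))\<^sup>2 = (\<Sum>w\<in>t. (norm (r w *\<^sub>R T w))\<^sup>2)"
      using norm_sum_Pythagorean[OF t(1) o(2)] by (simp add: t(3) T.sum T.scaleR)
    also have "\<dots> \<le> (\<Sum>w\<in>t. \<beta> * (norm (r w *\<^sub>R w))\<^sup>2)"
    proof (rule sum_mono)
      fix w assume "w \<in> t"
      then have "(r w)\<^sup>2 * (norm (T w))\<^sup>2 \<le> (r w)\<^sup>2 * (\<beta> * (norm w)\<^sup>2)"
        using lt[of w] t(2) by (intro mult_left_mono) (auto intro: less_imp_le)
      then show "(norm (r w *\<^sub>R T w))\<^sup>2 \<le> \<beta> * (norm (r w *\<^sub>R w))\<^sup>2"
        by (simp add: power_mult_distrib mult.left_commute)
    qed
    also have "\<dots> = \<beta> * (norm y)\<^sup>2"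
      using norm_sum_Pythagorean[OF t(1) o(1)] by (simp add: t(3) sum_distrib_left)
    finally show ?thesis .
  qed
  have le: "(norm (T y))\<^sup>2 \<le> \<beta> * (norm y)\<^sup>2" if "y \<in> ?M" for y
  proof -
    have "closed {y. (norm (T y))\<^sup>2 \<le> \<beta> * (norm y)\<^sup>2}"
      by (intro closed_Collect_le continuous_intros cont)
    from closure_minimal[OF _ this] show ?thesis using le_span that by blast
  qed
  assume "\<not> ?thesis"
  then have eq: "(norm (T x))\<^sup>2 = \<beta> * (norm x)\<^sup>2" using le[OF x(1)] by linarith
  have "x \<bullet> w = 0" if w: "w \<in> V" for w
  proof -
    \<comment> \<open>\<open>p\<close> is the polar form at \<open>x\<close> and \<open>w\<close>,
      and \<open>m\<close> is the value of the form at \<open>w\<close>.\<close>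
    define p where "p = \<beta> * (x \<bullet> w) - T x \<bullet> T w"
    define m where "m = \<beta> * (norm w)\<^sup>2 - (norm (T w))\<^sup>2"
    have m: "m > 0" using lt[OF w] by (simp add: m_def)
    have quad: "0 \<le> 2 * t * p + t\<^sup>2 * m" for t
    proof -
      have "x + t *\<^sub>R w \<in> ?M"
        using x(1) w closure_subset[of "span V"]
        by (intro subspace_add subspace_scale subspace_closure) (auto intro: span_base)
      from le[OF this] eq show ?thesis
        unfolding p_def m_def power2_norm_eq_inner
        by (simp add: T.add T.scaleR inner_add_left inner_add_right inner_commute algebra_simps
            power2_eq_square)
    qed
    \<comment> \<open>At its minimiser \<open>t = - p / m\<close> the quadratic takes the value
      \<open>- p\<^sup>2 / m\<close>.\<close>
    have "p = 0"
      using quad[of "- p / m"] m by (simp add: power2_eq_square field_simps)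
        (metis mult_le_0_iff order_antisym zero_le_mult_iff linear)
    \<comment> \<open>Both sides are linear and continuous in \<open>x\<close>, so it suffices to
      compare them on \<open>V\<close>, where all members other than \<open>w\<close> give zero on
      both sides.\<close>
    moreover have "(T x \<bullet> T w) * (norm w)\<^sup>2 = (norm (T w))\<^sup>2 * (x \<bullet> w)"
    proof -
      have "x \<in> {y. (T y \<bullet> T w) * (norm w)\<^sup>2 = (norm (T w))\<^sup>2 * (y \<bullet> w)}"
      proof (rule closure_span_induct[OF x(1)])
        fix v assume v: "v \<in> V"
        show "v \<in> {y. (T y \<bullet> T w) * (norm w)\<^sup>2 = (norm (T w))\<^sup>2 * (y \<bullet> w)}"
        proof (cases "v = w")
          case True
          then show ?thesis by (simp add: power2_norm_eq_inner)
        next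
          case False
          then show ?thesis using orth v w by (auto simp: pairwise_def orthogonal_def)
        qed
      next
        show "subspace {y. (T y \<bullet> T w) * (norm w)\<^sup>2 = (norm (T w))\<^sup>2 * (y \<bullet> w)}"
          by (auto simp: subspace_def T.zero T.add T.scaleR inner_add_left algebra_simps)
        show "closed {y. (T y \<bullet> T w) * (norm w)\<^sup>2 = (norm (T w))\<^sup>2 * (y \<bullet> w)}"
          by (intro closed_Collect_eq continuous_intros cont)
      qed
      then show ?thesis by simp
    qed
    moreover have "m * (x \<bullet> w) = (p + T x \<bullet> T w) * (norm w)\<^sup>2 - (norm (T w))\<^sup>2 * (x \<bullet> w)"
      by (simp add: p_def m_def algebra_simps)
    ultimately have "m * (x \<bullet> w) = 0" by simp
    then show ?thesis using m by simp
  qed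
  then have "x \<in> {y. x \<bullet> y = 0}"
    by (intro closure_span_induct[OF x(1)] closed_Collect_eq continuous_intros)
      (auto simp: subspace_def inner_add_right)
  then show False using x(2) by simp
qed

text \<open>Common setting for \<open>A\<close> and for the block operator. Infinite dimension
  enters in the form in which it is used: no finite set has trivial orthogonal complement.\<close>

locale complex_selfadjoint =
  fixes J :: "'a::{real_inner,complete_space} \<Rightarrow> 'a" and T :: "'a \<Rightarrow> 'a"
  assumes J: "complex_structure J"
    and T: "bounded_linear T"
    and TJ: "T (J x) = J (T x)"
    and sa: "T x \<bullet> y = x \<bullet> T y"
    and inf: "finite (B :: 'a set) \<Longrightarrow> \<exists>x\<in>B\<^sup>\<bottom>. x \<noteq> 0"
begin

sublocale T: bounded_linear T by (rule T)

sublocale J: bounded_linear J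
proof -
  have "norm (J x) = norm x" for x
    using J by (simp add: complex_structure_def norm_eq_sqrt_inner)
  then show "bounded_linear J"
    using J by (intro bounded_linear_intro[of _ 1])
      (simp_all add: complex_structure_def linear_add linear_scale)
qed

lemma JJ: "J (J x) = - x" and inner_JJ: "J x \<bullet> J y = x \<bullet> y"
  using J by (auto simp: complex_structure_def)

lemma norm_J: "norm (J x) = norm x"
  by (simp add: norm_eq_sqrt_inner inner_JJ)

lemma inner_J: "J x \<bullet> y = - (x \<bullet> J y)"
  using inner_JJ[of x "J y"] by (simp add: JJ)

lemma inner_J_swap: "x \<bullet> J y = - (y \<bullet> J x)"
  using inner_J[of y x] by (simp add: inner_commute)

lemma inner_J_self: "x \<bullet> J x = 0"
  using inner_J[of x x] by (simp add: inner_commute)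

lemma unit_vector_exists:
  assumes "finite (B :: 'a set)"
  shows "\<exists>x\<in>B\<^sup>\<bottom>. norm x = 1"
proof -
  obtain x where "x \<in> B\<^sup>\<bottom>" "x \<noteq> 0" using inf[OF assms] by blast
  then show ?thesis
    by (intro bexI[of _ "sgn x"]) (auto simp: norm_sgn sgn_div_norm mem_orthogonal_comp)
qed

text \<open>Take a unit vector \<open>x\<close> with value below \<beta> and a unit vector
  \<open>y\<close> with value close to \<beta> or above, orthogonal to \<open>x\<close> for both
  forms. On the arc \<open>sqrt (1 - \<theta>) *\<^sub>R x + sqrt \<theta> *\<^sub>R y\<close> the
  norm is 1 and the value is affine in \<theta>, so it passes through the desired interval.\<close>

lemma intermediate_value_exists:
  assumes low: "\<And>B. finite B \<Longrightarrow> \<exists>x\<in>B\<^sup>\<bottom>. (norm (T x))\<^sup>2 < \<beta> * (norm x)\<^sup>2"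
    and high: "\<And>B s. finite B \<Longrightarrow> s < \<beta> \<Longrightarrow> \<exists>x\<in>B\<^sup>\<bottom>. s * (norm x)\<^sup>2 < (norm (T x))\<^sup>2"
    and B: "finite B" and s: "s < \<beta>"
  shows "\<exists>x\<in>B\<^sup>\<bottom>. norm x = 1 \<and> s < (norm (T x))\<^sup>2 \<and> (norm (T x))\<^sup>2 < \<beta>"
proof -
  have unit: "norm (sgn v) = 1 \<and> (norm (T (sgn v)))\<^sup>2 = (norm (T v))\<^sup>2 / (norm v)\<^sup>2 \<and>
      (v \<in> B\<^sup>\<bottom> \<longrightarrow> sgn v \<in> B\<^sup>\<bottom>)" if "v \<noteq> 0" for v and B :: "'a set"
    using that by (auto simp: norm_sgn sgn_div_norm T.scaleR power_mult_distrib mem_orthogonal_comp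
        power_inverse divide_inverse mult.commute)
  obtain x0 where x0: "x0 \<in> B\<^sup>\<bottom>" "(norm (T x0))\<^sup>2 < \<beta> * (norm x0)\<^sup>2" using low[OF B] by blast
  then have "x0 \<noteq> 0" by (auto simp: T.zero)
  define x where "x = sgn x0"
  have x: "x \<in> B\<^sup>\<bottom>" "norm x = 1" "(norm (T x))\<^sup>2 < \<beta>"
    using unit[OF \<open>x0 \<noteq> 0\<close>, of B] x0 \<open>x0 \<noteq> 0\<close> by (auto simp: x_def pos_divide_less_eq)
  define p where "p = (norm (T x))\<^sup>2"
  \<comment> \<open>Taking the maximum with \<open>p\<close> ensures that \<open>y\<close> has a
    larger value than \<open>x\<close>, which puts \<theta> between 0 and 1.\<close>
  define s' where "s' = max p s"
  have s': "s' < \<beta>" "p \<le> s'" "s \<le> s'" using x(3) s by (auto simp: s'_def p_def)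
  \<comment> \<open>Orthogonality to \<open>T (T x)\<close> is orthogonality of \<open>T y0\<close>
    and \<open>T x\<close>, by self-adjointness.\<close>
  obtain y0 where y0: "y0 \<in> (B \<union> {x, T (T x)})\<^sup>\<bottom>" "s' * (norm y0)\<^sup>2 < (norm (T y0))\<^sup>2"
    using high[of "B \<union> {x, T (T x)}", OF _ s'(1)] B by auto
  then have "y0 \<noteq> 0" by (auto simp: T.zero)
  define y where "y = sgn y0"
  have y: "y \<in> (B \<union> {x, T (T x)})\<^sup>\<bottom>" "norm y = 1" "s' < (norm (T y))\<^sup>2"
    using unit[OF \<open>y0 \<noteq> 0\<close>, of "B \<union> {x, T (T x)}"] y0 \<open>y0 \<noteq> 0\<close> by (auto simp: y_def pos_less_divide_eq)
  have yB: "y \<in> B\<^sup>\<bottom>" and xy: "x \<bullet> y = 0" and Txy: "T x \<bullet> T y = 0"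
    using y(1) sa[of "T x" y] by (auto simp: mem_orthogonal_comp inner_commute[of y])
  define r where "r = (norm (T y))\<^sup>2"
  show ?thesis
  proof (cases "r < \<beta>")
    case True
    then show ?thesis using yB y s' by (intro bexI[of _ y]) (auto simp: r_def)
  next
    case False
    define t where "t = (s' + \<beta>) / 2"
    have t: "s' < t" "t < \<beta>" using s'(1) by (auto simp: t_def)
    define \<theta> where "\<theta> = (t - p) / (r - p)"
    have \<theta>: "0 \<le> \<theta>" "\<theta> \<le> 1" "p + \<theta> * (r - p) = t"
      using False t s' by (auto simp: \<theta>_def)
    define g where "g = sqrt (1 - \<theta>) *\<^sub>R x + sqrt \<theta> *\<^sub>R y"
    have "(norm g)\<^sup>2 = (norm (sqrt (1 - \<theta>) *\<^sub>R x))\<^sup>2 + (norm (sqrt \<theta> *\<^sub>R y))\<^sup>2"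
      unfolding g_def by (rule norm_add_Pythagorean) (simp add: orthogonal_def xy)
    also have "\<dots> = 1" using \<theta> x(2) y(2) by (simp add: power_mult_distrib)
    finally have "norm g = 1" by (simp add: power2_eq_1_iff) (smt (verit) norm_ge_zero)
    moreover have "(norm (T g))\<^sup>2 = (norm (sqrt (1 - \<theta>) *\<^sub>R T x))\<^sup>2 + (norm (sqrt \<theta> *\<^sub>R T y))\<^sup>2"
      unfolding g_def T.add T.scaleR by (rule norm_add_Pythagorean) (simp add: orthogonal_def Txy)
    then have "(norm (T g))\<^sup>2 = (1 - \<theta>) * p + \<theta> * r"
      using \<theta> by (simp add: power_mult_distrib p_def r_def)
    then have "(norm (T g))\<^sup>2 = t" using \<theta>(3) by (simp add: algebra_simps)
    moreover have "g \<in> B\<^sup>\<bottom>"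
      using x(1) yB by (simp add: g_def mem_orthogonal_comp inner_add_left)
    ultimately show ?thesis using t s' by (intro bexI[of _ g]) auto
  qed
qed

text \<open>With \<open>\<beta>\<close> the top of the essential spectrum of \<open>T\<^sup>2\<close>, failure of \<^const>\<open>ess_modulus\<close> yields an
  orthonormal, \<open>T\<close>-orthogonal sequence along which \<open>\<parallel>T e\<parallel>\<^sup>2\<close> approaches \<open>\<beta>\<close> strictly from below;
  \<open>T\<close> does not attain its norm on the closed span.\<close>

lemma ess_modulus_of_abs_norm_attaining:
  assumes AN: "abs_norm_attaining J T"
  shows "\<exists>\<beta>\<ge>0. ess_modulus \<beta> T"
proof -
  \<comment> \<open>The upper bounds valid on some complement. With \<beta> their infimum, the upper
    half of \<open>ess_modulus\<close> is automatic; only the lower half draws on norm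
    attainment.\<close>
  define S where "S = {s. \<exists>B. finite B \<and> (\<forall>x\<in>B\<^sup>\<bottom>. (norm (T x))\<^sup>2 \<le> s * (norm x)\<^sup>2)}"
  obtain k where k: "\<And>y. norm (T y) \<le> norm y * k" using T.bounded by blast
  have "k\<^sup>2 \<in> S"
    using power_mono[OF k norm_ge_zero, of _ 2]
    by (auto simp: S_def power_mult_distrib mult.commute intro: exI[of _ "{}"])
  have S_nonneg: "0 \<le> s" if s: "s \<in> S" for s
  proof -
    obtain B where B: "finite B" "\<And>x. x \<in> B\<^sup>\<bottom> \<Longrightarrow> (norm (T x))\<^sup>2 \<le> s * (norm x)\<^sup>2"
      using s unfolding S_def by blast
    obtain x where "x \<in> B\<^sup>\<bottom>" "norm x = 1" using unit_vector_exists[OF B(1)] by blast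
    then show ?thesis using order_trans[OF zero_le_power2 B(2)[of x]] by simp
  qed
  have bdd: "bdd_below S" using S_nonneg by (rule bdd_belowI)
  define \<beta> where "\<beta> = Inf S"
  have "0 \<le> \<beta>" unfolding \<beta>_def using \<open>k\<^sup>2 \<in> S\<close> S_nonneg by (intro cInf_greatest) auto
  have upper: "\<exists>B. finite B \<and> (\<forall>x\<in>B\<^sup>\<bottom>. (norm (T x))\<^sup>2 \<le> (\<beta> + \<epsilon>) * (norm x)\<^sup>2)" if "\<epsilon> > 0" for \<epsilon>
  proof -
    have "\<exists>s\<in>S. s < \<beta> + \<epsilon>"
      using that \<open>k\<^sup>2 \<in> S\<close> bdd by (subst cInf_less_iff[symmetric]) (auto simp: \<beta>_def)
    then obtain s B where "finite B" "s < \<beta> + \<epsilon>" "\<And>x. x \<in> B\<^sup>\<bottom> \<Longrightarrow> (norm (T x))\<^sup>2 \<le> s * (norm x)\<^sup>2"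
      by (auto simp: S_def)
    moreover from this have "s * (norm x)\<^sup>2 \<le> (\<beta> + \<epsilon>) * (norm x)\<^sup>2" for x :: 'a
      by (intro mult_right_mono) auto
    ultimately show ?thesis by (meson order_trans)
  qed
  have high: "\<exists>x\<in>B\<^sup>\<bottom>. s * (norm x)\<^sup>2 < (norm (T x))\<^sup>2" if "finite B" "s < \<beta>" for B s
  proof (rule ccontr)
    assume "\<not> ?thesis"
    then have "s \<in> S" using that(1) by (auto simp: S_def not_less)
    then have "\<beta> \<le> s" unfolding \<beta>_def by (rule cInf_lower[OF _ bdd])
    then show False using that(2) by simp
  qed
  have "\<exists>B. finite B \<and> (\<forall>x\<in>B\<^sup>\<bottom>. \<beta> * (norm x)\<^sup>2 \<le> (norm (T x))\<^sup>2)"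
  proof (rule ccontr)
    assume "\<not> ?thesis"
    then have low: "\<exists>x\<in>B\<^sup>\<bottom>. (norm (T x))\<^sup>2 < \<beta> * (norm x)\<^sup>2" if "finite B" for B
      using that by (meson not_less)
    define P where "P = (\<lambda>(n::nat) x. norm x = 1 \<and> \<beta> - inverse (real (Suc n)) < (norm (T x))\<^sup>2 \<and>
      (norm (T x))\<^sup>2 < \<beta>)"
    have "\<exists>x\<in>B\<^sup>\<bottom>. P n x" if "finite B" for n B
      unfolding P_def using intermediate_value_exists[OF low high that] by simp
    \<comment> \<open>The identity and \<open>J\<close> give complex orthogonality of the sequence;
      the two maps through \<open>T (T x)\<close> give it for the images under
      \<open>T\<close>.\<close>
    then have seq: "\<exists>e :: nat \<Rightarrow> 'a. (\<forall>n. P n (e n)) \<and>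
        (\<forall>m n. \<forall>g\<in>{\<lambda>x. x, J, \<lambda>x. T (T x), \<lambda>x. T (T (J x))}. m < n \<longrightarrow> e n \<bullet> g (e m) = 0)"
      by (intro orthogonal_sequence_exists) simp_all
    then obtain e :: "nat \<Rightarrow> 'a" where e: "\<And>n. P n (e n)"
      and o1: "\<And>m n. m < n \<Longrightarrow> e n \<bullet> e m = 0" "\<And>m n. m < n \<Longrightarrow> e n \<bullet> J (e m) = 0"
        "\<And>m n. m < n \<Longrightarrow> e n \<bullet> T (T (e m)) = 0" "\<And>m n. m < n \<Longrightarrow> e n \<bullet> T (T (J (e m))) = 0"
      by auto
    have o: "e n \<bullet> e m = 0" "T (e n) \<bullet> T (e m) = 0" if "m \<noteq> n" for m n
      using o1[of m n] o1[of n m] that inner_commute[of "e n" "e m"] inner_commute[of "T (e n)" "T (e m)"]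
      by (cases m n rule: linorder_cases; simp add: sa)+
    have oJ: "e n \<bullet> J (e m) = 0" "T (e n) \<bullet> J (T (e m)) = 0" for m n
      using o1[of m n] o1[of n m] inner_J_self inner_J_swap[of "e n" "e m"]
        inner_J_swap[of "T (e n)" "T (e m)"]
      by (cases m n rule: linorder_cases; simp add: sa TJ)+
    \<comment> \<open>With the vectors \<open>J (e n)\<close> included, the closed span is a complex
      subspace, as absolute norm attainment requires.\<close>
    define V where "V = range e \<union> range (\<lambda>n. J (e n))"
    have inner_V: "v \<bullet> w = 0 \<and> T v \<bullet> T w = 0" if vw: "v \<in> V" "w \<in> V" "v \<noteq> w" for v w
    proof -
      consider m n where "v = e m" "w = e n" | m n where "v = e m" "w = J (e n)"
        | m n where "v = J (e m)" "w = e n" | m n where "v = J (e m)" "w = J (e n)"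
        using vw by (auto simp: V_def)
      then show ?thesis
      proof cases
        case (1 m n)
        then show ?thesis using vw(3) o[of n m] by auto
      next
        case (4 m n)
        then show ?thesis using vw(3) o[of n m] by (auto simp: TJ inner_JJ)
      qed (simp_all add: TJ oJ inner_J)
    qed
    have normV: "(norm (T w))\<^sup>2 < \<beta> * (norm w)\<^sup>2" if "w \<in> V" for w
      using that e by (auto simp: V_def P_def TJ norm_J)
    define M where "M = closure (span V)"
    have eM: "e n \<in> M" for n
      using closure_subset[of "span V"] by (auto simp: M_def V_def intro: span_base)
    have "J x \<in> M" if "x \<in> M" for x
    proof -
      have "x \<in> J -` M"
      proof (rule closure_span_induct[OF that[unfolded M_def]])
        fix v assume "v \<in> V"
        have base: "e n \<in> span V" "J (e n) \<in> span V" for n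
          by (rule span_base, simp add: V_def)+
        from \<open>v \<in> V\<close> consider n where "v = e n" | n where "v = J (e n)"
          unfolding V_def by blast
        then have "J v \<in> span V"
          by cases (simp_all add: JJ base span_neg)
        then show "v \<in> J -` M" using closure_subset by (auto simp: M_def)
      next
        show "subspace (J -` M)"
          unfolding M_def by (intro J.linear_axioms linear_subspace_vimage subspace_closure subspace_span)
        show "closed (J -` M)"
          unfolding M_def by (intro closed_vimage closed_closure J.continuous_on continuous_on_id)
      qed
      then show ?thesis by simp
    qed
    moreover have sub: "subspace M" by (simp add: M_def subspace_closure)
    moreover have "M \<noteq> {0}" using eM[of 0] e[of 0] by (auto simp: P_def)
    ultimately have "norm_attaining_on T M"
      using AN by (simp add: abs_norm_attaining_def csubspace_def M_def)
    then obtain x where x: "x \<in> M" "norm x = 1" "\<And>y. y \<in> M \<Longrightarrow> norm (T y) \<le> norm (T x) * norm y"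
      unfolding norm_attaining_on_iff[OF T sub] by blast
    have "(norm (T x))\<^sup>2 < \<beta> * (norm x)\<^sup>2"
    proof (rule strict_bound_on_closed_span[OF T _ _ normV])
      show "pairwise orthogonal V" "pairwise (\<lambda>v w. orthogonal (T v) (T w)) V"
        using inner_V by (auto simp: pairwise_def orthogonal_def)
    qed (use x in \<open>auto simp: M_def\<close>)
    \<comment> \<open>The maximiser stays a fixed distance below \<beta>, while the values at
      \<open>e n\<close> come closer to \<beta> than that.\<close>
    then have "0 < \<beta> - (norm (T x))\<^sup>2" using x(2) by simp
    then obtain n where n: "inverse (real (Suc n)) < \<beta> - (norm (T x))\<^sup>2"
      using reals_Archimedean by blast
    have "norm (T (e n)) \<le> norm (T x)" using x(3)[OF eM[of n]] e[of n] by (simp add: P_def)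
    then have "(norm (T (e n)))\<^sup>2 \<le> (norm (T x))\<^sup>2" by (intro power_mono) auto
    then show False using e[of n] n unfolding P_def by linarith
  qed
  then show ?thesis using \<open>0 \<le> \<beta>\<close> upper unfolding ess_modulus_def by blast
qed

end

subsection \<open>Essential spectrum\<close>

text \<open>For \<open>f\<close> outside \<open>S\<close>, the distance \<open>d\<close> from
  \<open>f\<close> to \<open>S\<close> is positive and
  \<open>\<bar>r\<bar> * d \<le> norm (a + r *\<^sub>R f)\<close>. So the coefficients of a
  convergent sequence of sums are Cauchy, and then the \<open>S\<close>-components converge
  too.\<close>

lemma closed_add_line:
  fixes S :: "'a::real_normed_vector set"
  assumes S: "subspace S" "closed S"
  shows "closed {a + r *\<^sub>R f | a r. a \<in> S}"
proof (cases "f \<in> S")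
  case True
  have "a + r *\<^sub>R f \<in> S" if "a \<in> S" for a r
    using that True S(1) by (intro subspace_add subspace_scale)
  moreover have "\<exists>a' r. a = a' + r *\<^sub>R f \<and> a' \<in> S" if "a \<in> S" for a
    using that by (intro exI[of _ a] exI[of _ 0]) simp
  ultimately have "{a + r *\<^sub>R f | a r. a \<in> S} = S" by blast
  then show ?thesis using S(2) by simp
next
  case False
  define d where "d = infdist f S"
  have S0: "0 \<in> S" using S(1) by (rule subspace_0)
  then have d: "d > 0"
    unfolding d_def using False S(2) by (intro infdist_pos_not_in_closed) auto
  have bound: "\<bar>r\<bar> * d \<le> norm (a + r *\<^sub>R f)" if "a \<in> S" for a r
  proof (cases "r = 0")
    case False
    have "(- inverse r) *\<^sub>R a \<in> S" using that S(1) by (intro subspace_scale)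
    then have "d \<le> dist f ((- inverse r) *\<^sub>R a)" unfolding d_def by (rule infdist_le)
    then have "\<bar>r\<bar> * d \<le> \<bar>r\<bar> * norm (f + inverse r *\<^sub>R a)"
      by (intro mult_left_mono) (auto simp: dist_norm)
    also have "\<dots> = norm (r *\<^sub>R (f + inverse r *\<^sub>R a))" by simp
    also have "r *\<^sub>R (f + inverse r *\<^sub>R a) = a + r *\<^sub>R f"
      using False by (simp add: scaleR_add_right)
    finally show ?thesis .
  qed simp
  show ?thesis
    unfolding closed_sequential_limits
  proof (intro allI impI, elim conjE)
    fix x z assume x: "\<forall>n. x n \<in> {a + r *\<^sub>R f | a r. a \<in> S}" and lim: "x \<longlonglongrightarrow> z"
    from x have "\<forall>n. \<exists>a r. x n = a + r *\<^sub>R f \<and> a \<in> S" by blast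
    then obtain a r where ar: "\<And>n. x n = a n + r n *\<^sub>R f" "\<And>n. a n \<in> S" by metis
    have "Cauchy r"
    proof (rule CauchyI)
      fix e :: real assume "e > 0"
      then have "e * d > 0" using d by simp
      then obtain N where N: "\<And>m n. m \<ge> N \<Longrightarrow> n \<ge> N \<Longrightarrow> norm (x m - x n) < e * d"
        using CauchyD[OF LIMSEQ_imp_Cauchy[OF lim]] by blast
      have "norm (r m - r n) < e" if "m \<ge> N" "n \<ge> N" for m n
      proof -
        have "\<bar>r m - r n\<bar> * d \<le> norm ((a m - a n) + (r m - r n) *\<^sub>R f)"
          using ar(2) S(1) by (intro bound subspace_diff)
        also have "(a m - a n) + (r m - r n) *\<^sub>R f = x m - x n"
          by (simp add: ar(1) algebra_simps)
        also have "norm (x m - x n) < e * d" using N that by blast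
        finally show ?thesis using d by simp
      qed
      then show "\<exists>M. \<forall>m\<ge>M. \<forall>n\<ge>M. norm (r m - r n) < e" by blast
    qed
    then obtain \<rho> where \<rho>: "r \<longlonglongrightarrow> \<rho>"
      using Cauchy_convergent convergent_def by blast
    have "(\<lambda>n. x n - r n *\<^sub>R f) \<longlonglongrightarrow> z - \<rho> *\<^sub>R f"
      by (intro tendsto_intros lim \<rho>)
    then have "a \<longlonglongrightarrow> z - \<rho> *\<^sub>R f" by (simp add: ar(1))
    then have "z - \<rho> *\<^sub>R f \<in> S" using closed_sequentially[OF S(2)] ar(2) by blast
    then show "z \<in> {a + r *\<^sub>R f | a r. a \<in> S}"
      by (intro CollectI exI[of _ "z - \<rho> *\<^sub>R f"] exI[of _ \<rho>]) simp
  qed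
qed

lemma closed_add_span_finite:
  fixes S :: "'a::real_normed_vector set"
  assumes S: "subspace S" "closed S" and "finite F"
  shows "closed {a + b | a b. a \<in> S \<and> b \<in> span F}"
  using assms(3)
proof (induction F)
  case empty
  then show ?case using S(2) by simp
next
  case (insert f F)
  let ?S = "{a + b | a b. a \<in> S \<and> b \<in> span F}"
  have "closed {a + r *\<^sub>R f | a r. a \<in> ?S}"
    using insert S(1) by (intro closed_add_line subspace_sums) auto
  moreover have "{a + r *\<^sub>R f | a r. a \<in> ?S} = {a + b | a b. a \<in> S \<and> b \<in> span (insert f F)}"
  proof (intro set_eqI iffI)
    fix z assume "z \<in> {a + r *\<^sub>R f | a r. a \<in> ?S}"
    then obtain a b r where z: "z = a + b + r *\<^sub>R f" "a \<in> S" "b \<in> span F" by blast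
    have "b + r *\<^sub>R f \<in> span (insert f F)"
      using z(3) by (auto simp: span_insert intro!: exI[of _ r])
    then show "z \<in> {a + b | a b. a \<in> S \<and> b \<in> span (insert f F)}"
      using z by (auto simp: add.assoc)
  next
    fix z assume "z \<in> {a + b | a b. a \<in> S \<and> b \<in> span (insert f F)}"
    then obtain a b k where z: "z = a + b" "a \<in> S" "b - k *\<^sub>R f \<in> span F"
      by (auto simp: span_insert)
    then have "z = (a + (b - k *\<^sub>R f)) + k *\<^sub>R f" by simp
    then show "z \<in> {a + r *\<^sub>R f | a r. a \<in> ?S}" using z by blast
  qed
  ultimately show ?case by simp
qed

section \<open>Complex spans and scalars modulo compact operators\<close>

lemma span_subset_cspan: "span B \<subseteq> cspan J B"
proof
  fix y assume "y \<in> span B"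
  then obtain t r where "finite t" "t \<subseteq> B" "y = (\<Sum>w\<in>t. r w *\<^sub>R w)"
    by (auto simp: span_explicit)
  then show "y \<in> cspan J B"
    unfolding cspan_def scaleC_def
    by (intro CollectI exI[of _ t] exI[of _ "\<lambda>w. complex_of_real (r w)"]) simp
qed

lemma cspan_subset_span: "cspan J B \<subseteq> span (B \<union> J ` B)"
  unfolding cspan_def scaleC_def
  by (auto intro!: span_sum span_add span_scale intro: span_base)

text \<open>For bounded linear \<open>T\<close> this says that \<open>T\<close> minus \<alpha> times
  the identity is compact, phrased through complements of finite sets only.\<close>

definition ess_scalar :: "real \<Rightarrow> ('a::real_inner \<Rightarrow> 'a) \<Rightarrow> bool" where
  "ess_scalar \<alpha> T \<longleftrightarrow> (\<forall>\<epsilon>>0. \<exists>B. finite B \<and> (\<forall>x\<in>B\<^sup>\<bottom>. norm (T x - \<alpha> *\<^sub>R x) \<le> \<epsilon> * norm x))"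

lemma ess_scalarE:
  assumes "ess_scalar \<alpha> T" "\<epsilon> > 0"
  obtains B where "finite B" "\<And>x. x \<in> B\<^sup>\<bottom> \<Longrightarrow> norm (T x - \<alpha> *\<^sub>R x) \<le> \<epsilon> * norm x"
  using assms unfolding ess_scalar_def by meson

context complex_selfadjoint
begin

text \<open>The form of \<open>G\<close>, the square of \<open>T\<close> minus \<beta>, is small on
  a complement, and polarisation makes \<open>G\<close> itself small there. With \<alpha> the root
  of \<beta>, \<open>G\<close> factors as \<open>T + \<alpha>\<close> times
  \<open>T - \<alpha>\<close>, and positivity bounds the first factor below by \<alpha>.\<close>

lemma ess_scalar_of_ess_modulus:
  assumes pos: "\<And>x. 0 \<le> T x \<bullet> x" and ess: "ess_modulus \<beta> T" and \<beta>: "0 \<le> \<beta>"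
  shows "ess_scalar (sqrt \<beta>) T"
  unfolding ess_scalar_def
proof (intro allI impI)
  fix \<epsilon> :: real assume \<epsilon>: "\<epsilon> > 0"
  show "\<exists>B. finite B \<and> (\<forall>x\<in>B\<^sup>\<bottom>. norm (T x - sqrt \<beta> *\<^sub>R x) \<le> \<epsilon> * norm x)"
  \<comment> \<open>The factorisation argument divides by the root of \<beta>. For zero the upper
    bound alone, with \<open>\<epsilon>\<^sup>2\<close>, is the claim.\<close>
  proof (cases "\<beta> = 0")
    case True
    have "\<epsilon>\<^sup>2 > 0" using \<epsilon> by simp
    obtain B where B: "finite B" "\<And>x. x \<in> B\<^sup>\<bottom> \<Longrightarrow> (norm (T x))\<^sup>2 \<le> \<epsilon>\<^sup>2 * (norm x)\<^sup>2"
      by (rule ess_modulus_upperE[OF ess \<open>\<epsilon>\<^sup>2 > 0\<close>]) (use True in simp)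
    have "norm (T x) \<le> \<epsilon> * norm x" if "x \<in> B\<^sup>\<bottom>" for x
      by (rule power2_le_imp_le) (use B(2)[OF that] \<epsilon> in \<open>simp_all add: power_mult_distrib\<close>)
    then show ?thesis using True B(1) by auto
  next
    case False
    define \<alpha> where "\<alpha> = sqrt \<beta>"
    have \<alpha>: "\<alpha> > 0" "\<alpha>\<^sup>2 = \<beta>" using False \<beta> by (auto simp: \<alpha>_def)
    define \<delta> where "\<delta> = \<epsilon> * \<alpha>"
    have \<delta>: "\<delta> > 0" using \<epsilon> \<alpha> by (simp add: \<delta>_def)
    obtain B1 where B1: "finite B1" "\<And>x. x \<in> B1\<^sup>\<bottom> \<Longrightarrow> \<beta> * (norm x)\<^sup>2 \<le> (norm (T x))\<^sup>2"
      by (rule ess_modulus_lowerE[OF ess]) (rule that)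
    obtain B2 where B2: "finite B2" "\<And>x. x \<in> B2\<^sup>\<bottom> \<Longrightarrow> (norm (T x))\<^sup>2 \<le> (\<beta> + \<delta>) * (norm x)\<^sup>2"
      by (rule ess_modulus_upperE[OF ess \<delta>]) (rule that)
    define B where "B = B1 \<union> B2"
    define G where "G = (\<lambda>x. T (T x) - \<beta> *\<^sub>R x)"
    have G_lin: "G (x + y) = G x + G y" "G (x - y) = G x - G y" "G (c *\<^sub>R x) = c *\<^sub>R G x" for x y c
      by (simp_all add: G_def T.add T.diff T.scaleR algebra_simps)
    have G_sa: "G x \<bullet> y = x \<bullet> G y" for x y
      by (simp add: G_def inner_diff_left inner_diff_right sa)
    have G_form: "\<bar>G x \<bullet> x\<bar> \<le> \<delta> * (norm x)\<^sup>2" if "x \<in> B\<^sup>\<bottom>" for x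
    proof -
      have "x \<in> B1\<^sup>\<bottom>" "x \<in> B2\<^sup>\<bottom>" using that by (auto simp: B_def mem_orthogonal_comp)
      moreover have "G x \<bullet> x = (norm (T x))\<^sup>2 - \<beta> * (norm x)\<^sup>2"
        by (simp add: G_def inner_diff_left sa power2_norm_eq_inner)
      ultimately show ?thesis
        using B1(2)[of x] B2(2)[of x] \<delta> by (simp add: algebra_simps)
    qed
    \<comment> \<open>Polarising \<open>G x \<bullet> y\<close> with \<open>y\<close> a multiple of
      \<open>G x\<close> requires \<open>G x\<close> to lie in \<open>B\<^sup>\<bottom>\<close> as
      well; since \<open>G\<close> is symmetric, this is orthogonality of \<open>x\<close> to the
      image of \<open>B\<close>.\<close>
    define B' where "B' = B \<union> G ` B"
    have "norm (T x - \<alpha> *\<^sub>R x) \<le> \<epsilon> * norm x" if "x \<in> B'\<^sup>\<bottom>" for x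
    proof -
      have xB: "x \<in> B\<^sup>\<bottom>" using that by (auto simp: B'_def mem_orthogonal_comp)
      have GB: "G x \<in> B\<^sup>\<bottom>" using that by (auto simp: B'_def mem_orthogonal_comp G_sa)
      \<comment> \<open>This scaling turns the polarisation estimate into \<open>4 * (norm (G
        x))\<^sup>2 / \<delta> \<le> 2 * \<delta> * (norm x)\<^sup>2 + 2 * (norm (G x))\<^sup>2 /
        \<delta>\<close>, where the last term is absorbed.\<close>
      define y where "y = inverse \<delta> *\<^sub>R G x"
      have yB: "y \<in> B\<^sup>\<bottom>" using GB by (simp add: y_def mem_orthogonal_comp)
      have "4 * (G x \<bullet> y) = G (x + y) \<bullet> (x + y) - G (x - y) \<bullet> (x - y)"
        using G_sa[of x y] G_sa[of y x]
        by (simp add: G_lin inner_add_left inner_add_right inner_diff_left inner_diff_right inner_commute)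
      also have "\<dots> \<le> \<delta> * (norm (x + y))\<^sup>2 + \<delta> * (norm (x - y))\<^sup>2"
        using G_form[OF subspace_add[OF subspace_orthogonal_comp xB yB]]
          G_form[OF subspace_diff[OF subspace_orthogonal_comp xB yB]] by linarith
      also have "\<dots> = \<delta> * (2 * (norm x)\<^sup>2 + 2 * (norm y)\<^sup>2)"
        by (simp only: parallelogram flip: distrib_left)
      finally have "4 * (G x \<bullet> y) \<le> \<delta> * (2 * (norm x)\<^sup>2 + 2 * (norm y)\<^sup>2)" .
      moreover have "G x \<bullet> y = (norm (G x))\<^sup>2 / \<delta>"
        by (simp add: y_def power2_norm_eq_inner divide_inverse mult.commute)
      moreover have "\<delta> * (norm y)\<^sup>2 = (norm (G x))\<^sup>2 / \<delta>"
        using \<delta> by (simp add: y_def power_mult_distrib field_simps power2_eq_square)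
      ultimately have "(norm (G x))\<^sup>2 / \<delta> \<le> \<delta> * (norm x)\<^sup>2" by (simp add: distrib_left)
      then have "(norm (G x))\<^sup>2 \<le> (\<delta> * norm x)\<^sup>2"
        using \<delta> by (simp add: field_simps power2_eq_square)
      then have Gx: "norm (G x) \<le> \<delta> * norm x"
        by (rule power2_le_imp_le) (use \<delta> in simp)
      define u where "u = T x - \<alpha> *\<^sub>R x"
      have "G x = T u + \<alpha> *\<^sub>R u"
        by (simp add: G_def u_def T.diff T.scaleR algebra_simps flip: \<alpha>(2))
          (simp add: power2_eq_square)
      then have "(norm (G x))\<^sup>2 = (norm (T u))\<^sup>2 + 2 * \<alpha> * (T u \<bullet> u) + \<alpha>\<^sup>2 * (norm u)\<^sup>2"
        unfolding power2_norm_eq_inner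
        by (simp add: inner_add_left inner_add_right inner_commute power2_eq_square algebra_simps)
      then have "(\<alpha> * norm u)\<^sup>2 \<le> (norm (G x))\<^sup>2"
        using pos[of u] \<alpha>(1) by (simp add: power_mult_distrib)
      then have "\<alpha> * norm u \<le> norm (G x)" by (rule power2_le_imp_le) simp
      also note Gx
      finally show ?thesis using \<alpha>(1) by (simp add: \<delta>_def u_def)
    qed
    moreover have "finite B'" using B1(1) B2(1) by (simp add: B'_def B_def)
    ultimately show ?thesis unfolding \<alpha>_def by blast
  qed
qed

section \<open>Fredholm property of \<open>T\<close> minus a complex scalar\<close>

lemma norm_scaleC: "norm (scaleC J c x) = cmod c * norm x"
proof -
  have "(norm (scaleC J c x))\<^sup>2 = (norm (Re c *\<^sub>R x))\<^sup>2 + (norm (Im c *\<^sub>R J x))\<^sup>2"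
    unfolding scaleC_def by (rule norm_add_Pythagorean) (simp add: orthogonal_def inner_J_self)
  also have "\<dots> = (cmod c * norm x)\<^sup>2"
    by (simp add: norm_J power_mult_distrib cmod_power2 algebra_simps)
  finally show ?thesis by (simp add: power2_eq_iff_nonneg)
qed

lemma scaleC_diff_right: "scaleC J c (x - y) = scaleC J c x - scaleC J c y"
  by (simp add: scaleC_def J.diff algebra_simps)

lemma scaleC_diff_left: "scaleC J (c - d) x = scaleC J c x - scaleC J d x"
  by (simp add: scaleC_def algebra_simps)

lemma scaleC_scaleC: "scaleC J c (scaleC J d x) = scaleC J (c * d) x"
  by (simp add: scaleC_def J.add J.scaleR JJ algebra_simps)

lemma scaleC_of_real: "scaleC J (complex_of_real r) x = r *\<^sub>R x"
  by (simp add: scaleC_def)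

lemma bounded_linear_scaleC: "bounded_linear (scaleC J c)"
  unfolding scaleC_def
  by (intro bounded_linear_add bounded_linear_const_scaleR bounded_linear_ident J.bounded_linear_axioms)

text \<open>If \<open>T - \<alpha>\<close> had range of finite codimension, then \<open>y = \<Sum> 2\<^sup>-\<^sup>n u\<^sub>n\<close>, for orthonormal \<open>u\<^sub>n\<close> with
  \<open>\<parallel>(T - \<alpha>) u\<^sub>n\<parallel> \<le> 4\<^sup>-\<^sup>n\<close>, would be \<open>(T - \<alpha>) x + w\<close> with \<open>w \<bottom> u\<^sub>n\<close>; pairing with \<open>u\<^sub>n\<close> gives \<open>2\<^sup>n \<le> \<parallel>x\<parallel>\<close>.\<close>

lemma not_fredholm_of_ess_scalar:
  assumes ess: "ess_scalar \<alpha> T"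
  shows "\<not> fredholm J J (\<lambda>x. T x - scaleC J (complex_of_real \<alpha>) x)"
proof
  assume fr: "fredholm J J (\<lambda>x. T x - scaleC J (complex_of_real \<alpha>) x)"
  define S where "S = (\<lambda>x. T x - \<alpha> *\<^sub>R x)"
  have S_sa: "S x \<bullet> y = x \<bullet> S y" for x y
    by (simp add: S_def inner_diff_left inner_diff_right sa)
  obtain B where B: "finite B" "\<And>y. \<exists>x w. w \<in> cspan J B \<and> y = S x + w"
    using fr unfolding fredholm_def S_def scaleC_of_real by blast
  \<comment> \<open>Real orthogonality to this set gives orthogonality to the whole complex span of
    \<open>B\<close>.\<close>
  define B' where "B' = B \<union> J ` B"
  define P where "P = (\<lambda>n u. norm u = 1 \<and> norm (S u) \<le> (1/4) ^ n \<and> u \<in> B'\<^sup>\<bottom>)"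
  have "\<exists>u\<in>F\<^sup>\<bottom>. P n u" if "finite F" for n F
  proof -
    have pos: "(1/4::real) ^ n > 0" by simp
    obtain B2 where B2: "finite B2" "\<And>x. x \<in> B2\<^sup>\<bottom> \<Longrightarrow> norm (S x) \<le> (1/4) ^ n * norm x"
      by (rule ess_scalarE[OF ess pos]) (rule that, simp_all add: S_def)
    have "finite (F \<union> B' \<union> B2)" using that B(1) B2(1) by (simp add: B'_def)
    from unit_vector_exists[OF this] obtain u where "u \<in> (F \<union> B' \<union> B2)\<^sup>\<bottom>" "norm u = 1"
      by blast
    then show ?thesis
      using B2(2)[of u] by (intro bexI[of _ u]) (auto simp: P_def mem_orthogonal_comp)
  qed
  then have "\<exists>u :: nat \<Rightarrow> 'a. (\<forall>n. P n (u n)) \<and> (\<forall>m n. \<forall>g\<in>{\<lambda>x. x}. m < n \<longrightarrow> u n \<bullet> g (u m) = 0)"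
    by (intro orthogonal_sequence_exists) simp_all
  then obtain u :: "nat \<Rightarrow> 'a" where u: "\<And>n. P n (u n)" and o1: "\<And>m n. m < n \<Longrightarrow> u n \<bullet> u m = 0"
    by auto
  have o: "u n \<bullet> u m = (if n = m then 1 else 0)" for n m
    using o1[of m n] o1[of n m] u[of n] inner_commute[of "u n" "u m"]
    by (cases m n rule: linorder_cases) (auto simp: P_def dot_square_norm)
  define s where "s = (\<lambda>N. \<Sum>n<N. (1/2) ^ n *\<^sub>R u n)"
  define g where "g = (\<lambda>N. \<Sum>n<N. (1/2::real) ^ n)"
  have s_le: "norm (s m - s n) \<le> \<bar>g m - g n\<bar>" if "n \<le> m" for m n
  proof -
    have "norm (s m - s n) = norm (\<Sum>k\<in>{n..<m}. (1/2) ^ k *\<^sub>R u k)"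
      using sum_diff_nat_ivl[of 0 n m "\<lambda>k. (1/2) ^ k *\<^sub>R u k"] that by (simp add: s_def lessThan_atLeast0)
    also have "\<dots> \<le> (\<Sum>k\<in>{n..<m}. (1/2) ^ k)"
      using u by (intro sum_norm_le) (simp add: P_def)
    also have "\<dots> = g m - g n"
      using sum_diff_nat_ivl[of 0 n m "\<lambda>k. (1/2::real) ^ k"] that by (simp add: g_def lessThan_atLeast0)
    finally show ?thesis by simp
  qed
  have "Cauchy g"
    unfolding g_def
    by (rule LIMSEQ_imp_Cauchy[OF summable_LIMSEQ[OF summable_geometric]]) simp
  then have "Cauchy s"
  proof -
    have "norm (s m - s n) \<le> norm (g m - g n)" for m n
      using s_le[of n m] s_le[of m n] by (cases "n \<le> m") (auto simp: norm_minus_commute)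
    then show ?thesis
      using CauchyD[OF \<open>Cauchy g\<close>] by (intro CauchyI) (meson le_less_trans)
  qed
  then obtain y where y: "s \<longlonglongrightarrow> y"
    using Cauchy_convergent convergent_def by blast
  have yu: "y \<bullet> u k = (1/2) ^ k" for k
  proof (rule LIMSEQ_unique)
    show "(\<lambda>N. s N \<bullet> u k) \<longlonglongrightarrow> y \<bullet> u k" by (intro tendsto_intros y)
    have "s N \<bullet> u k = (1/2) ^ k" if "N > k" for N
    proof -
      have "s N \<bullet> u k = (\<Sum>n<N. if n = k then (1/2) ^ n else 0)"
        unfolding s_def inner_sum_left by (intro sum.cong) (auto simp: o)
      then show ?thesis using that by simp
    qed
    then show "(\<lambda>N. s N \<bullet> u k) \<longlonglongrightarrow> (1/2) ^ k"
      by (intro tendsto_eventually eventually_sequentiallyI[of "Suc k"]) auto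
  qed
  obtain x w where x: "w \<in> cspan J B" "y = S x + w" using B(2) by blast
  have "2 ^ k \<le> norm x" for k
  proof -
    have "u k \<bullet> w = 0"
      using u[of k] x(1) cspan_subset_span[of J B]
      by (intro orthogonal_comp_span[of _ B']) (auto simp: P_def B'_def)
    then have "(1/2) ^ k = x \<bullet> S (u k)"
      using yu[of k] x(2) by (simp add: inner_add_left S_sa inner_commute[of w])
    also have "\<dots> \<le> norm x * norm (S (u k))" by (rule norm_cauchy_schwarz)
    also have "\<dots> \<le> norm x * (1/4) ^ k"
      using u[of k] by (intro mult_left_mono) (auto simp: P_def)
    finally have "(1/2) ^ k * 4 ^ k \<le> norm x * (1/4) ^ k * 4 ^ k" by (intro mult_right_mono) auto
    then show ?thesis by (simp add: mult.assoc flip: power_mult_distrib)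
  qed
  moreover obtain k where "norm x < 2 ^ k" using real_arch_pow[of 2 "norm x"] by auto
  ultimately show False using not_less by blast
qed

text \<open>On \<open>B\<^sup>\<bottom>\<close> the operator \<open>D\<close> is a nonzero scalar
  plus a part of at most half its size, hence bounded below. So the kernel meets
  \<open>B\<^sup>\<bottom>\<close> only in 0, and the range is a complete subspace plus a
  finite-dimensional one. For the codimension, \<open>S\<close> is replaced by its compression
  \<open>P S P\<close>: the perturbed scalar is onto by the Banach fixed point theorem, and the
  replacement costs only a finite-dimensional error.\<close>

lemma fredholm_of_ess_scalar:
  assumes ess: "ess_scalar \<alpha> T" and c: "c \<noteq> complex_of_real \<alpha>"
  shows "fredholm J J (\<lambda>x. T x - scaleC J c x)"
proof -
  define \<mu> where "\<mu> = complex_of_real \<alpha> - c"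
  have \<mu>: "\<mu> \<noteq> 0" using c by (simp add: \<mu>_def)
  define S where "S = (\<lambda>x. T x - \<alpha> *\<^sub>R x)"
  define D where "D = (\<lambda>x. T x - scaleC J c x)"
  have D_eq: "D x = S x + scaleC J \<mu> x" for x
    by (simp add: D_def S_def \<mu>_def scaleC_diff_left scaleC_of_real)
  have "bounded_linear S" "bounded_linear D"
    unfolding S_def D_def
    by (intro bounded_linear_sub T bounded_linear_const_scaleR bounded_linear_ident bounded_linear_scaleC)+
  interpret S: bounded_linear S by fact
  interpret D: bounded_linear D by fact
  define \<epsilon> where "\<epsilon> = cmod \<mu> / 2"
  have \<epsilon>: "\<epsilon> > 0" "cmod \<mu> = 2 * \<epsilon>" using \<mu> by (auto simp: \<epsilon>_def)
  obtain B where B: "finite B" "\<And>x. x \<in> B\<^sup>\<bottom> \<Longrightarrow> norm (S x) \<le> \<epsilon> * norm x"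
    by (rule ess_scalarE[OF ess \<epsilon>(1)]) (rule that, simp_all add: S_def)
  obtain P where P: "linear P" "\<And>x. x - P x \<in> span B" "\<And>x. P x \<in> B\<^sup>\<bottom>" "\<And>x. norm (P x) \<le> norm x"
    using orthogonal_projection_finite[OF B(1)] by blast
  have below: "\<epsilon> * norm x \<le> norm (D x)" if "x \<in> B\<^sup>\<bottom>" for x
    using B(2)[OF that] norm_triangle_ineq4[of "D x" "S x"]
    by (simp add: D_eq norm_scaleC \<epsilon>(2))
  have kernel: "cfinite_dim J {x. D x = 0}"
  proof -
    have "subspace {x. D x = 0}" by (rule linear_subspace_kernel[OF D.linear_axioms])
    moreover have "{x. D x = 0} \<inter> B\<^sup>\<bottom> \<subseteq> {0}"
      using below \<epsilon>(1) by (fastforce simp: mult_le_0_iff)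
    ultimately obtain C where "finite C" "{x. D x = 0} \<subseteq> span C"
      using finite_dim_of_trivial_annihilator[OF B(1)] by blast
    then show ?thesis
      unfolding cfinite_dim_def using span_subset_cspan by blast
  qed
  have range: "closed (range D)"
  proof -
    have "complete (D ` (B\<^sup>\<bottom>))"
      using below
      by (intro complete_isometric_image[OF \<epsilon>(1) subspace_orthogonal_comp D.bounded_linear_axioms])
        (auto simp: complete_eq_closed closed_orthogonal_comp)
    then have "closed (D ` (B\<^sup>\<bottom>))" by (rule complete_imp_closed)
    moreover have "subspace (D ` (B\<^sup>\<bottom>))"
      by (intro linear_subspace_image D.linear_axioms subspace_orthogonal_comp)
    ultimately have "closed {a + b | a b. a \<in> D ` (B\<^sup>\<bottom>) \<and> b \<in> span (D ` B)}"
      using B(1) by (intro closed_add_span_finite) auto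
    moreover have "range D = {a + b | a b. a \<in> D ` (B\<^sup>\<bottom>) \<and> b \<in> span (D ` B)}"
    proof (intro set_eqI iffI)
      fix y assume "y \<in> range D"
      then obtain x where "y = D x" by blast
      then have "y = D (P x) + D (x - P x)" by (simp add: D.diff)
      moreover have "D (x - P x) \<in> span (D ` B)"
        using P(2) by (simp add: linear_span_image[OF D.linear_axioms])
      ultimately show "y \<in> {a + b | a b. a \<in> D ` (B\<^sup>\<bottom>) \<and> b \<in> span (D ` B)}"
        using P(3) by blast
    next
      fix y assume "y \<in> {a + b | a b. a \<in> D ` (B\<^sup>\<bottom>) \<and> b \<in> span (D ` B)}"
      then show "y \<in> range D"
        by (auto simp: linear_span_image[OF D.linear_axioms] simp flip: D.add)
    qed
    ultimately show ?thesis by simp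
  qed
  have codim: "\<exists>x w. w \<in> cspan J (B \<union> S ` B) \<and> y = D x + w" for y
  proof -
    \<comment> \<open>A fixed point of \<open>F\<close> solves
      \<open>scaleC J \<mu> x + P (S (P x)) = y\<close>; \<open>F\<close> contracts by 1/2 because
      \<epsilon> is half of \<open>cmod \<mu>\<close>.\<close>
    define F where "F = (\<lambda>x. scaleC J (1 / \<mu>) (y - P (S (P x))))"
    have "\<exists>!x. F x = x"
    proof (rule banach_fix_type[of "1/2" F])
      show "\<forall>x x'. dist (F x) (F x') \<le> 1/2 * dist x x'"
      proof (intro allI)
        fix x x' :: 'a
        have "F x - F x' = scaleC J (1 / \<mu>) (P (S (P (x' - x))))"
          by (simp add: F_def linear_diff[OF P(1)] S.diff flip: scaleC_diff_right)
        then have "dist (F x) (F x') = norm (P (S (P (x' - x)))) / cmod \<mu>"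
          by (simp add: dist_norm norm_scaleC norm_divide)
        also have "norm (P (S (P (x' - x)))) \<le> norm (S (P (x' - x)))" by (rule P(4))
        also have "\<dots> \<le> \<epsilon> * norm (P (x' - x))" by (rule B(2)[OF P(3)])
        also have "\<dots> \<le> \<epsilon> * norm (x' - x)" using \<epsilon>(1) P(4) by simp
        finally show "dist (F x) (F x') \<le> 1/2 * dist x x'"
          using \<epsilon> by (simp add: dist_norm norm_minus_commute field_simps)
      qed
    qed auto
    then obtain x where "F x = x" by blast
    then have "scaleC J \<mu> x = scaleC J \<mu> (F x)" by simp
    also have "\<dots> = y - P (S (P x))"
      using \<mu> by (simp add: F_def scaleC_scaleC) (simp add: scaleC_def)
    \<comment> \<open>The error \<open>S x - P (S (P x))\<close> is regrouped so that one piece lies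
      in \<open>span B\<close> and the other in the image of \<open>span B\<close> under
      \<open>S\<close>.\<close>
    finally have "y = D x + (- (S (P x) - P (S (P x))) - S (x - P x))"
      by (simp add: D_eq S.diff)
    moreover have "S (P x) - P (S (P x)) \<in> span (B \<union> S ` B)"
      using P(2)[of "S (P x)"] span_mono[of B "B \<union> S ` B"] by blast
    moreover have "S (x - P x) \<in> span (B \<union> S ` B)"
    proof -
      have "S (x - P x) \<in> span (S ` B)"
        using P(2) by (simp add: linear_span_image[OF S.linear_axioms])
      then show ?thesis using span_mono[of "S ` B" "B \<union> S ` B"] by blast
    qed
    ultimately show ?thesis using span_subset_cspan span_diff[OF span_neg] by blast
  qed
  have "finite (B \<union> S ` B)" using B(1) by simp
  then show ?thesis
    using kernel range codim unfolding fredholm_def D_def by blast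
qed

lemma ess_spectrum_of_ess_scalar:
  assumes "ess_scalar \<alpha> T"
  shows "ess_spectrum J T = {complex_of_real \<alpha>}"
  using not_fredholm_of_ess_scalar[OF assms] fredholm_of_ess_scalar[OF assms]
  by (auto simp: ess_spectrum_def)

end

subsection \<open>Positive block operators\<close>

text \<open>Reality of the quadratic form means \<open>A z \<bullet> J z = 0\<close>; at
  \<open>z = x + J y\<close> the cross terms of this identity are exactly the symmetry of
  \<open>A\<close>.\<close>

lemma positive_op_selfadjoint:
  assumes J: "complex_structure J" and A: "linear A" "\<And>x. A (J x) = J (A x)"
    and pos: "positive_op J A"
  shows "A x \<bullet> y = x \<bullet> A y"
proof -
  have im: "A z \<bullet> J z = 0" for z
    using pos by (simp add: positive_op_def cinner_def)
  have "A (x + J y) \<bullet> J (x + J y) = A x \<bullet> J x + A x \<bullet> J (J y) + J (A y) \<bullet> J x + A (J y) \<bullet> J (J y)"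
    using J A by (simp add: complex_structure_def linear_add inner_add_left inner_add_right
        inner_diff_right)
  also have "\<dots> = - (A x \<bullet> y) + A y \<bullet> x"
    using J im[of x] im[of "J y"] by (simp add: complex_structure_def)
  finally show ?thesis using im[of "x + J y"] by (simp add: inner_commute)
qed

lemma positive_op_nonneg: "positive_op J A \<Longrightarrow> 0 \<le> A x \<bullet> x"
  by (simp add: positive_op_def cinner_def)

lemma complex_hilbert_nonzero_orthogonal:
  fixes J :: "'a::{real_inner,complete_space} \<Rightarrow> 'a"
  assumes H: "complex_hilbert J" and B: "finite (B :: 'a set)"
  shows "\<exists>x\<in>B\<^sup>\<bottom>. x \<noteq> 0"
proof (rule ccontr)
  assume "\<not> ?thesis"
  then have "UNIV \<inter> B\<^sup>\<bottom> \<subseteq> {0}" by blast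
  then obtain C where "finite C" "(UNIV :: 'a set) \<subseteq> span C"
    using finite_dim_of_trivial_annihilator[OF B subspace_UNIV] by blast
  then have "cfinite_dim J (UNIV :: 'a set)"
    unfolding cfinite_dim_def using span_subset_cspan by blast
  then show False using H by (simp add: complex_hilbert_def)
qed

lemma complex_selfadjoint_of_positive_op:
  fixes J :: "'a::{real_inner,complete_space} \<Rightarrow> 'a"
  assumes J: "complex_structure J" and T: "bounded_linear T" "\<And>x. T (J x) = J (T x)"
    and pos: "positive_op J T" and inf: "\<And>B :: 'a set. finite B \<Longrightarrow> \<exists>x\<in>B\<^sup>\<bottom>. x \<noteq> 0"
  shows "complex_selfadjoint J T"
proof (rule complex_selfadjoint.intro)
  show "T x \<bullet> y = x \<bullet> T y" for x y
    using positive_op_selfadjoint[OF J bounded_linear.linear[OF T(1)] T(2) pos] .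
qed (use J T inf in auto)

section \<open>The block operator, its corners and the adjoint of \<open>X\<close>\<close>

locale positive_block =
  fixes J1 :: "'a::{real_inner,complete_space} \<Rightarrow> 'a"
    and J2 :: "'b::{real_inner,complete_space} \<Rightarrow> 'b"
    and A :: "'b \<Rightarrow> 'b" and X :: "'b \<Rightarrow> 'a" and Xs :: "'a \<Rightarrow> 'b"
  assumes H1: "complex_hilbert J1"
    and H2: "complex_hilbert J2"
    and A_bd: "bounded_op J2 J2 A" and A_pos: "positive_op J2 A"
    and X_bd: "bounded_op J2 J1 X"
    and Xs_adj: "\<forall>y x. cinner J1 (X y) x = cinner J2 y (Xs x)"
    and T_pos: "positive_op (prod_J J1 J2) (block_op X Xs A)"
begin

lemma J1: "complex_structure J1" and J2: "complex_structure J2"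
  using H1 H2 by (auto simp: complex_hilbert_def)

sublocale A: complex_selfadjoint J2 A
  using A_bd J2 A_pos complex_hilbert_nonzero_orthogonal[OF H2]
  by (intro complex_selfadjoint_of_positive_op) (auto simp: bounded_op_def clinear_def)

sublocale X: bounded_linear X
  using X_bd by (simp add: bounded_op_def)

lemma XJ: "X (J2 y) = J1 (X y)"
  using X_bd by (simp add: bounded_op_def clinear_def)

lemma adjoint: "X y \<bullet> x = y \<bullet> Xs x"
  using Xs_adj by (simp add: cinner_def)

text \<open>The adjoint identity determines \<open>Xs\<close>: linearity follows by testing against
  all vectors, and the bound from
  \<open>norm (Xs x) * norm (Xs x) = X (Xs x) \<bullet> x\<close>.\<close>

sublocale Xs: bounded_linear Xs
proof -
  have "Xs (x + x') = Xs x + Xs x'" for x x'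
    by (subst vector_eq_ldot[symmetric]) (simp add: inner_add_right flip: adjoint)
  moreover have "Xs (r *\<^sub>R x) = r *\<^sub>R Xs x" for r x
    by (subst vector_eq_ldot[symmetric]) (simp flip: adjoint)
  moreover obtain K where K: "\<And>y. norm (X y) \<le> norm y * K" "0 \<le> K"
    using X.nonneg_bounded by blast
  have "norm (Xs x) \<le> norm x * K" for x
  proof (cases "Xs x = 0")
    case False
    have "norm (Xs x) * norm (Xs x) = X (Xs x) \<bullet> x"
      by (simp add: adjoint dot_square_norm power2_eq_square)
    also have "\<dots> \<le> norm (X (Xs x)) * norm x" by (rule norm_cauchy_schwarz)
    also have "\<dots> \<le> (norm (Xs x) * K) * norm x" by (intro mult_right_mono K) simp
    finally show ?thesis using False by (simp add: mult.assoc mult.commute)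
  qed (simp add: K)
  ultimately show "bounded_linear Xs" by (intro bounded_linear_intro)
qed

lemma XsJ: "Xs (J1 x) = J2 (Xs x)"
proof -
  have "X y \<bullet> J1 x = y \<bullet> J2 (Xs x)" for y
    using arg_cong[OF Xs_adj[rule_format, of y x], of Im] by (simp add: cinner_def)
  then have "y \<bullet> Xs (J1 x) = y \<bullet> J2 (Xs x)" for y
    by (simp flip: adjoint)
  then show ?thesis using vector_eq_ldot by blast
qed

abbreviation T :: "'a \<times> 'b \<Rightarrow> 'a \<times> 'b" where
  "T \<equiv> block_op X Xs A"

lemma T_Pair: "T (x, y) = (x + X y, Xs x + A y)"
  by (simp add: block_op_def)

lemma pair_orthogonal:
  assumes "x \<in> (fst ` B)\<^sup>\<bottom>" "y \<in> (snd ` B)\<^sup>\<bottom>"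
  shows "(x, y) \<in> B\<^sup>\<bottom>"
  using assms by (force simp: mem_orthogonal_comp inner_prod_def)

sublocale T: complex_selfadjoint "prod_J J1 J2" T
proof (rule complex_selfadjoint_of_positive_op[OF _ _ _ T_pos])
  show "complex_structure (prod_J J1 J2)"
    using J1 J2
    by (auto simp: complex_structure_def prod_J_def inner_prod_def intro!: linearI
        simp: linear_add linear_scale)
  have "T = (\<lambda>z. (fst z + X (snd z), Xs (fst z) + A (snd z)))"
    by (auto simp: block_op_def)
  moreover have "bounded_linear (\<lambda>z. (fst z + X (snd z), Xs (fst z) + A (snd z)))"
    by (intro bounded_linear_Pair bounded_linear_add bounded_linear_fst
        bounded_linear_compose[OF X.bounded_linear_axioms bounded_linear_snd]
        bounded_linear_compose[OF Xs.bounded_linear_axioms bounded_linear_fst]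
        bounded_linear_compose[OF A.T bounded_linear_snd])
  ultimately show "bounded_linear T" by simp
  show "T (prod_J J1 J2 z) = prod_J J1 J2 (T z)" for z
    using J1 J2
    by (cases z) (simp add: prod_J_def T_Pair XJ XsJ A.TJ complex_structure_def linear_add)
  fix B :: "('a \<times> 'b) set" assume "finite B"
  then obtain x where "x \<in> (fst ` B)\<^sup>\<bottom>" "x \<noteq> 0"
    using complex_hilbert_nonzero_orthogonal[OF H1, of "fst ` B"] by auto
  then show "\<exists>z\<in>B\<^sup>\<bottom>. z \<noteq> 0"
    by (intro bexI[of _ "(x, 0)"] pair_orthogonal)
      (auto simp: mem_orthogonal_comp zero_prod_def)
qed

lemma A_nonneg: "0 \<le> A y \<bullet> y"
  by (rule positive_op_nonneg[OF A_pos])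

lemma T_nonneg: "0 \<le> T z \<bullet> z"
  by (rule positive_op_nonneg[OF T_pos])

text \<open>The kernel of \<open>Xs\<close> is the orthogonal complement of the range of
  \<open>X\<close>. If it contains \<open>C\<^sup>\<bottom>\<close>, the range meets
  \<open>C\<^sup>\<bottom>\<close> only in 0, so finitely many functionals separate its
  points.\<close>

lemma cfinite_dim_range_iff:
  "cfinite_dim J1 (range X) \<longleftrightarrow> (\<exists>C. finite C \<and> (\<forall>x\<in>C\<^sup>\<bottom>. Xs x = 0))"
proof
  assume "cfinite_dim J1 (range X)"
  then obtain C where C: "finite C" "range X \<subseteq> cspan J1 C" by (auto simp: cfinite_dim_def)
  have "Xs x = 0" if x: "x \<in> (C \<union> J1 ` C)\<^sup>\<bottom>" for x
  proof -
    have "X (Xs x) \<in> span (C \<union> J1 ` C)" using C(2) cspan_subset_span by blast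
    from orthogonal_comp_span[OF x this] show ?thesis
      by (simp add: inner_commute[of x] adjoint)
  qed
  then show "\<exists>C. finite C \<and> (\<forall>x\<in>C\<^sup>\<bottom>. Xs x = 0)"
    using C(1) by (intro exI[of _ "C \<union> J1 ` C"]) simp
next
  assume "\<exists>C. finite C \<and> (\<forall>x\<in>C\<^sup>\<bottom>. Xs x = 0)"
  then obtain C where C: "finite C" "\<forall>x\<in>C\<^sup>\<bottom>. Xs x = 0" by blast
  have "range X \<inter> C\<^sup>\<bottom> \<subseteq> {0}"
  proof
    fix z assume "z \<in> range X \<inter> C\<^sup>\<bottom>"
    then obtain y where "z = X y" "Xs z = 0" using C(2) by blast
    then have "z \<bullet> z = 0" using adjoint[of y z] by simp
    then show "z \<in> {0}" by simp
  qed
  moreover have "subspace (range X)"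
    by (intro linear_subspace_image X.linear_axioms subspace_UNIV)
  ultimately obtain C' where "finite C'" "range X \<subseteq> span C'"
    using finite_dim_of_trivial_annihilator[OF C(1)] by blast
  then show "cfinite_dim J1 (range X)"
    unfolding cfinite_dim_def using span_subset_cspan by blast
qed

text \<open>For \<open>y\<close> orthogonal to the image of \<open>C\<close> under
  \<open>Xs\<close>, \<open>X y\<close> lies in \<open>C\<^sup>\<bottom>\<close>, so
  \<open>Xs (X y) = 0\<close> and hence \<open>X y = 0\<close>. Away from finitely many directions
  the block operator is therefore the direct sum of the identity and \<open>A\<close>, and the
  identity summand satisfies both bounds for the value 1.\<close>

lemma ess_modulus_block_op_iff:
  assumes C: "finite C" "\<And>x. x \<in> C\<^sup>\<bottom> \<Longrightarrow> Xs x = 0"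
  shows "ess_modulus 1 T \<longleftrightarrow> ess_modulus 1 A"
proof -
  define D where "D = Xs ` C"
  have D: "finite D" using C(1) by (simp add: D_def)
  have X0: "X y = 0" if "y \<in> D\<^sup>\<bottom>" for y
  proof -
    have "X y \<in> C\<^sup>\<bottom>" using that by (auto simp: D_def mem_orthogonal_comp adjoint)
    then have "X y \<bullet> X y = 0" using C(2) by (simp add: adjoint)
    then show ?thesis by simp
  qed
  have T_eq: "(norm (T (x, y)))\<^sup>2 = (norm x)\<^sup>2 + (norm (A y))\<^sup>2" if "x \<in> C\<^sup>\<bottom>" "y \<in> D\<^sup>\<bottom>" for x y
    using C(2)[OF that(1)] X0[OF that(2)] by (simp add: T_Pair norm_prod_def)
  \<comment> \<open>\<open>L\<close> turns a test set for the block operator into one for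
    \<open>A\<close>; \<open>R\<close> below goes the other way.\<close>
  define L where "L = (\<lambda>B::('a \<times> 'b) set. snd ` B \<union> D)"
  have L: "finite B \<Longrightarrow> finite (L B)" "y \<in> (L B)\<^sup>\<bottom> \<Longrightarrow> (0, y) \<in> B\<^sup>\<bottom>"
    "y \<in> (L B)\<^sup>\<bottom> \<Longrightarrow> norm (A y) = norm (T (0, y))" for B y
    using D X0[of y] pair_orthogonal[of 0 B y]
    by (auto simp: L_def mem_orthogonal_comp T_Pair Xs.zero)
  define R where "R = (\<lambda>B::'b set. (\<lambda>c. (c, 0)) ` C \<union> (\<lambda>d. (0, d)) ` (B \<union> D))"
  have R: "finite B \<Longrightarrow> finite (R B)" "(x, y) \<in> (R B)\<^sup>\<bottom> \<Longrightarrow> y \<in> B\<^sup>\<bottom>"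
    "(x, y) \<in> (R B)\<^sup>\<bottom> \<Longrightarrow> (norm (T (x, y)))\<^sup>2 = (norm x)\<^sup>2 + (norm (A y))\<^sup>2" for B x y
    using C(1) D T_eq[of x y] by (auto simp: R_def mem_orthogonal_comp ball_Un inner_prod_def)
  show ?thesis
  proof
    assume ess: "ess_modulus 1 T"
    show "ess_modulus 1 A"
      unfolding ess_modulus_def
    proof (intro conjI allI impI)
      obtain B where B: "finite B" "\<And>z. z \<in> B\<^sup>\<bottom> \<Longrightarrow> 1 * (norm z)\<^sup>2 \<le> (norm (T z))\<^sup>2"
        by (rule ess_modulus_lowerE[OF ess]) (rule that)
      have "1 * (norm y)\<^sup>2 \<le> (norm (A y))\<^sup>2" if "y \<in> (L B)\<^sup>\<bottom>" for y
        using B(2)[OF L(2)[OF that]] L(3)[OF that] by simp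
      then show "\<exists>B. finite B \<and> (\<forall>y\<in>B\<^sup>\<bottom>. 1 * (norm y)\<^sup>2 \<le> (norm (A y))\<^sup>2)"
        using L(1)[OF B(1)] by blast
    next
      fix \<epsilon> :: real assume \<epsilon>: "\<epsilon> > 0"
      obtain B where B: "finite B" "\<And>z. z \<in> B\<^sup>\<bottom> \<Longrightarrow> (norm (T z))\<^sup>2 \<le> (1 + \<epsilon>) * (norm z)\<^sup>2"
        by (rule ess_modulus_upperE[OF ess \<epsilon>]) (rule that)
      have "(norm (A y))\<^sup>2 \<le> (1 + \<epsilon>) * (norm y)\<^sup>2" if "y \<in> (L B)\<^sup>\<bottom>" for y
        using B(2)[OF L(2)[OF that]] L(3)[OF that] by simp
      then show "\<exists>B. finite B \<and> (\<forall>y\<in>B\<^sup>\<bottom>. (norm (A y))\<^sup>2 \<le> (1 + \<epsilon>) * (norm y)\<^sup>2)"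
        using L(1)[OF B(1)] by blast
    qed
  next
    assume ess: "ess_modulus 1 A"
    show "ess_modulus 1 T"
      unfolding ess_modulus_def
    proof (intro conjI allI impI)
      obtain B where B: "finite B" "\<And>y. y \<in> B\<^sup>\<bottom> \<Longrightarrow> 1 * (norm y)\<^sup>2 \<le> (norm (A y))\<^sup>2"
        by (rule ess_modulus_lowerE[OF ess]) (rule that)
      have "1 * (norm z)\<^sup>2 \<le> (norm (T z))\<^sup>2" if "z \<in> (R B)\<^sup>\<bottom>" for z
        using that B(2)[OF R(2)[of "fst z" "snd z"]] R(3)[of "fst z" "snd z"]
        by (cases z) (simp add: norm_prod_def)
      then show "\<exists>B. finite B \<and> (\<forall>z\<in>B\<^sup>\<bottom>. 1 * (norm z)\<^sup>2 \<le> (norm (T z))\<^sup>2)"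
        using R(1)[OF B(1)] by blast
    next
      fix \<epsilon> :: real assume \<epsilon>: "\<epsilon> > 0"
      obtain B where B: "finite B" "\<And>y. y \<in> B\<^sup>\<bottom> \<Longrightarrow> (norm (A y))\<^sup>2 \<le> (1 + \<epsilon>) * (norm y)\<^sup>2"
        by (rule ess_modulus_upperE[OF ess \<epsilon>]) (rule that)
      have "(norm (T z))\<^sup>2 \<le> (1 + \<epsilon>) * (norm z)\<^sup>2" if z: "z \<in> (R B)\<^sup>\<bottom>" for z
      proof -
        obtain x y where xy: "z = (x, y)" by (cases z)
        have "(norm x)\<^sup>2 \<le> (1 + \<epsilon>) * (norm x)\<^sup>2" using \<epsilon> by (simp add: algebra_simps)
        then show ?thesis
          using B(2)[OF R(2)[of x y]] R(3)[of x y] z by (simp add: xy norm_prod_def algebra_simps)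
      qed
      then show "\<exists>B. finite B \<and> (\<forall>z\<in>B\<^sup>\<bottom>. (norm (T z))\<^sup>2 \<le> (1 + \<epsilon>) * (norm z)\<^sup>2)"
        using R(1)[OF B(1)] by blast
    qed
  qed
qed

text \<open>On vectors \<open>(x, 0)\<close> the first component of
  \<open>T z - \<alpha> *\<^sub>R z\<close> is \<open>(1 - \<alpha>) *\<^sub>R x\<close>, and the
  infinite dimension of the first space leaves such vectors in every complement.\<close>

lemma ess_scalar_block_op_eq_1:
  assumes "ess_scalar \<alpha> T"
  shows "\<alpha> = 1"
proof -
  have "\<bar>1 - \<alpha>\<bar> \<le> 0 + \<epsilon>" if \<epsilon>: "\<epsilon> > 0" for \<epsilon>
  proof -
    obtain B where B: "finite B" "\<And>z. z \<in> B\<^sup>\<bottom> \<Longrightarrow> norm (T z - \<alpha> *\<^sub>R z) \<le> \<epsilon> * norm z"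
      by (rule ess_scalarE[OF assms \<epsilon>]) (rule that)
    obtain x where x: "x \<in> (fst ` B)\<^sup>\<bottom>" "x \<noteq> 0"
      using complex_hilbert_nonzero_orthogonal[OF H1, of "fst ` B"] B(1) by auto
    have "(x, 0) \<in> B\<^sup>\<bottom>"
      using x(1) by (intro pair_orthogonal) (auto simp: mem_orthogonal_comp)
    from B(2)[OF this] have "norm ((1 - \<alpha>) *\<^sub>R x, Xs x) \<le> \<epsilon> * norm x"
      by (simp add: T_Pair X.zero A.T.zero norm_prod_def algebra_simps)
    then have "norm ((1 - \<alpha>) *\<^sub>R x) \<le> \<epsilon> * norm x"
      using norm_fst_le[of "(1 - \<alpha>) *\<^sub>R x" "Xs x"] by simp
    then show ?thesis using x(2) by simp
  qed
  then have "\<bar>1 - \<alpha>\<bar> \<le> 0" by (rule field_le_epsilon)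
  then show ?thesis by simp
qed

text \<open>The test vector \<open>(x, - X\<^sup>* x / 2)\<close> lowers \<open>\<parallel>T v\<parallel>\<^sup>2 - \<parallel>v\<parallel>\<^sup>2\<close> to about \<open>- \<parallel>X\<^sup>* x\<parallel>\<^sup>2\<close>, which is
  negative unless \<open>X\<^sup>* x = 0\<close>.\<close>

lemma adjoint_vanishes_on_finite_codim:
  assumes ess: "ess_modulus 1 T" and sc: "ess_scalar 1 T"
  shows "\<exists>C. finite C \<and> (\<forall>x\<in>C\<^sup>\<bottom>. Xs x = 0)"
proof -
  obtain B where B: "finite B" "\<And>v. v \<in> B\<^sup>\<bottom> \<Longrightarrow> 1 * (norm v)\<^sup>2 \<le> (norm (T v))\<^sup>2"
    by (rule ess_modulus_lowerE[OF ess]) (rule that)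
  have quarter: "(1/4::real) > 0" by simp
  obtain E where E: "finite E" "\<And>v. v \<in> E\<^sup>\<bottom> \<Longrightarrow> norm (T v - 1 *\<^sub>R v) \<le> 1/4 * norm v"
    by (rule ess_scalarE[OF sc quarter]) (rule that)
  \<comment> \<open>The image under \<open>X\<close> makes \<open>Xs x\<close> orthogonal to the
    second components of \<open>B\<close> and \<open>E\<close>, by the adjoint identity.\<close>
  define C where "C = fst ` B \<union> X ` snd ` (B \<union> E)"
  have "Xs x = 0" if x: "x \<in> C\<^sup>\<bottom>" for x
  proof -
    define z where "z = Xs x"
    have z_perp: "z \<in> (snd ` (B \<union> E))\<^sup>\<bottom>"
    proof -
      have "z \<bullet> r = x \<bullet> X r" for r
        using adjoint[of r x] by (simp add: z_def inner_commute)
      then show ?thesis using x by (auto simp: mem_orthogonal_comp C_def)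
    qed
    define a where "a = X z"
    define d where "d = A z - z"
    have "(0, z) \<in> E\<^sup>\<bottom>"
      using z_perp by (intro pair_orthogonal) (auto simp: mem_orthogonal_comp)
    \<comment> \<open>\<open>(a, d)\<close> is the difference between the block operator and the
      identity, applied to \<open>(0, z)\<close>.\<close>
    from E(2)[OF this] have small: "norm (a, d) \<le> 1/4 * norm z"
      by (simp add: T_Pair Xs.zero a_def d_def norm_prod_def)
    have a: "norm a \<le> 1/4 * norm z" and d: "norm d \<le> 1/4 * norm z"
      by (rule order_trans[OF norm_fst_le small], rule order_trans[OF norm_snd_le small])
    have ad: "(norm a)\<^sup>2 + (norm d)\<^sup>2 \<le> (1/4 * norm z)\<^sup>2"
      using power_mono[OF small norm_ge_zero, of 2] by (simp add: norm_prod_def)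
    have "x \<bullet> a = (norm z)\<^sup>2"
      using adjoint[of z x] by (simp add: a_def z_def power2_norm_eq_inner inner_commute)
    have zd: "- (z \<bullet> d) \<le> norm z * (1/4 * norm z)"
      using Cauchy_Schwarz_ineq2[of z d] mult_left_mono[OF d norm_ge_zero[of z]] by linarith
    \<comment> \<open>For \<open>(x, t *\<^sub>R z)\<close> the leading part of
      \<open>(norm (T v))\<^sup>2 - (norm v)\<^sup>2\<close> is
      \<open>(1 + 4 * t) * (norm z)\<^sup>2\<close>, negative once \<open>t < -1/4\<close>; at
      \<open>t = -1/2\<close> the coefficient is -1, with room for the errors from \<open>a\<close>
      and \<open>d\<close>.\<close>
    define v where "v = (x, - (1/2) *\<^sub>R z)"
    have "v \<in> B\<^sup>\<bottom>"
      unfolding v_def using x z_perp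
      by (intro pair_orthogonal) (auto simp: C_def mem_orthogonal_comp)
    from B(2)[OF this] have le: "(norm v)\<^sup>2 \<le> (norm (T v))\<^sup>2" by simp
    have nv: "(norm v)\<^sup>2 = (norm x)\<^sup>2 + (norm z)\<^sup>2 / 4"
      by (simp add: v_def norm_prod_def power_mult_distrib power_divide)
    have "T v = (x - (1/2) *\<^sub>R a, (1/2) *\<^sub>R (z - d))"
      by (simp add: v_def T_Pair X.scaleR X.neg A.T.scaleR A.T.neg a_def d_def flip: z_def)
        (simp add: algebra_simps flip: scaleR_add_left)
    note le
    also have "(norm (T v))\<^sup>2 = (norm (x - (1/2) *\<^sub>R a))\<^sup>2 + (norm ((1/2) *\<^sub>R (z - d)))\<^sup>2"
      by (simp add: \<open>T v = _\<close> norm_prod_def)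
    also have "\<dots> = (norm x)\<^sup>2 - x \<bullet> a + (norm a)\<^sup>2 / 4 + ((norm z)\<^sup>2 - 2 * (z \<bullet> d) + (norm d)\<^sup>2) / 4"
      unfolding power2_norm_eq_inner
      by (simp add: inner_diff_left inner_diff_right inner_commute algebra_simps
          add_divide_distrib diff_divide_distrib)
    also have "\<dots> = (norm x)\<^sup>2 - (norm z)\<^sup>2 + (norm z)\<^sup>2 / 4
        + ((norm a)\<^sup>2 + (norm d)\<^sup>2) / 4 - (z \<bullet> d) / 2"
      using \<open>x \<bullet> a = (norm z)\<^sup>2\<close> by (simp add: add_divide_distrib diff_divide_distrib)
    finally have "(norm v)\<^sup>2 \<le> (norm x)\<^sup>2 - (norm z)\<^sup>2 + (norm z)\<^sup>2 / 4
        + ((norm a)\<^sup>2 + (norm d)\<^sup>2) / 4 - (z \<bullet> d) / 2" .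
    moreover have "- (z \<bullet> d) \<le> (norm z)\<^sup>2 / 4"
      using zd by (simp add: power2_eq_square)
    moreover have "(norm a)\<^sup>2 + (norm d)\<^sup>2 \<le> (norm z)\<^sup>2 / 16"
      using ad by (simp add: power_mult_distrib power_divide)
    \<comment> \<open>The errors amount to at most \<open>Z / 64 + Z / 8\<close> against the main
      term \<open>- Z\<close>.\<close>
    moreover have "Z \<le> 0" if "V \<le> N - Z + Z / 4 + Q / 4 - w / 2" "V = N + Z / 4" "- w \<le> Z / 4" "Q \<le> Z / 16"
      for V N Z Q w :: real
      using that by linarith
    ultimately have "(norm z)\<^sup>2 \<le> 0" using nv by blast
    then show ?thesis by (simp add: z_def)
  qed
  moreover have "finite C" using B(1) E(1) by (simp add: C_def)
  ultimately show ?thesis by blast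
qed

lemma abs_norm_attaining_block_op_iff:
  "abs_norm_attaining (prod_J J1 J2) T \<longleftrightarrow>
    abs_norm_attaining J2 A \<and> ess_spectrum J2 A = {1} \<and> cfinite_dim J1 (range X)"
proof
  assume "abs_norm_attaining (prod_J J1 J2) T"
  then obtain \<beta> where \<beta>: "0 \<le> \<beta>" "ess_modulus \<beta> T"
    using T.ess_modulus_of_abs_norm_attaining by blast
  have sc: "ess_scalar (sqrt \<beta>) T"
    by (rule T.ess_scalar_of_ess_modulus[OF T_nonneg \<beta>(2,1)])
  have "sqrt \<beta> = 1" by (rule ess_scalar_block_op_eq_1[OF sc])
  then have ess: "ess_modulus 1 T" and sc1: "ess_scalar 1 T" using \<beta> sc by simp_all
  obtain C where C: "finite C" "\<And>x. x \<in> C\<^sup>\<bottom> \<Longrightarrow> Xs x = 0"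
    using adjoint_vanishes_on_finite_codim[OF ess sc1] by auto
  have ess_A: "ess_modulus 1 A"
    using ess ess_modulus_block_op_iff[OF C] by simp
  have "abs_norm_attaining J2 A"
    by (rule abs_norm_attaining_of_ess_modulus[OF A.T ess_A])
  moreover have "ess_spectrum J2 A = {1}"
    using A.ess_spectrum_of_ess_scalar[OF A.ess_scalar_of_ess_modulus[OF A_nonneg ess_A]] by simp
  moreover have "cfinite_dim J1 (range X)"
    unfolding cfinite_dim_range_iff by (rule adjoint_vanishes_on_finite_codim[OF ess sc1])
  ultimately show "abs_norm_attaining J2 A \<and> ess_spectrum J2 A = {1} \<and> cfinite_dim J1 (range X)"
    by blast
next
  assume R: "abs_norm_attaining J2 A \<and> ess_spectrum J2 A = {1} \<and> cfinite_dim J1 (range X)"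
  then obtain \<beta> where \<beta>: "0 \<le> \<beta>" "ess_modulus \<beta> A"
    using A.ess_modulus_of_abs_norm_attaining by blast
  \<comment> \<open>Norm attainment of \<open>A\<close> provides some \<beta>; the hypothesis on the
    essential spectrum identifies it as 1.\<close>
  have "ess_spectrum J2 A = {complex_of_real (sqrt \<beta>)}"
    by (rule A.ess_spectrum_of_ess_scalar[OF A.ess_scalar_of_ess_modulus[OF A_nonneg \<beta>(2,1)]])
  then have "complex_of_real (sqrt \<beta>) = 1" using R by simp
  then have "\<beta> = 1" by simp
  obtain C where C: "finite C" "\<And>x. x \<in> C\<^sup>\<bottom> \<Longrightarrow> Xs x = 0"
    using R unfolding cfinite_dim_range_iff by auto
  have "ess_modulus 1 T"
    using \<beta>(2) \<open>\<beta> = 1\<close> ess_modulus_block_op_iff[OF C] by simp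
  then show "abs_norm_attaining (prod_J J1 J2) T"
    by (rule abs_norm_attaining_of_ess_modulus[OF T.T])
qed

end

theorem theorem3p17:
  fixes J1 :: "'a::{real_inner,complete_space} \<Rightarrow> 'a"
    and J2 :: "'b::{real_inner,complete_space} \<Rightarrow> 'b"
    and A :: "'b \<Rightarrow> 'b" and X :: "'b \<Rightarrow> 'a" and Xs :: "'a \<Rightarrow> 'b"
  assumes H1: "complex_hilbert J1"
    and H2: "complex_hilbert J2"
    and A_bd: "bounded_op J2 J2 A" and A_pos: "positive_op J2 A"
    and X_bd: "bounded_op J2 J1 X"
    and Xs_adj: "\<forall>y x. cinner J1 (X y) x = cinner J2 y (Xs x)"
    and T_pos: "positive_op (prod_J J1 J2) (block_op X Xs A)"
  shows "abs_norm_attaining (prod_J J1 J2) (block_op X Xs A) \<longleftrightarrow>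
         (abs_norm_attaining J2 A \<and> ess_spectrum J2 A = {1} \<and> cfinite_dim J1 (range X))"
proof -
  interpret positive_block J1 J2 A X Xs
    by (rule positive_block.intro; fact)
  show ?thesis by (rule abs_norm_attaining_block_op_iff)
qed

end
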